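(* Let $\alpha\in(0,1)$, $\beta\ge 0$, $q\in L_1(0,1)$, let $n$ be a positive integer, and let $\lambda_n^{(j)},u_n^{(j)}$ ($j\ge 0$), $s_n$, $\widetilde c_n$, $M_n$, $R$ and $r_n$ be the quantities defined in the context. Suppose that $r_n<1$. Then the FD-method converges superexponentially to an exact solution of the linear problem $$u''(x)-\bigl[\beta\delta(x-\alpha)+q(x)\bigr]u(x)+\lambda u(x)=0,\quad x\in(0,1)\setminus\{\alpha\},\qquad u(0)=u(1)=0,\quad u'(0)=1,$$ in the following sense. The series $\sum_{j\ge0}\lambda_n^{(j)}$ converges, the series $\sum_{j\ge0}u_n^{(j)}$ converges uniformly on $[0,1]$, their sums $\lambda_n$ and $u_n$ form a solution of this problem, and for every integer $m\ge 0$ the partial sums $\lambda_n^{[m]}=\sum_{j=0}^m\lambda_n^{(j)}$ and $u_n^{[m]}=\sum_{j=0}^m u_n^{(j)}$ satisfy $$\bigl\|u_n-u_n^{[m]}\bigr\|_\infty\le C_{n,m}\min\Bigl\{\frac1{M_n},\ \frac1{s_n},\ \frac1{s_n\sqrt{\widetilde c_n}}\Bigr\}\,r_n^{m+1},$$ $$\bigl|\lambda_n-\lambda_n^{[m]}\bigr|\le \frac{C_{n,m}}{\Bigl(M_n+\max\bigl\{1,\ \widetilde c_n,\ \sqrt{\widetilde c_n}\,M_n/s_n\bigr\}\Bigr)R}\;r_n^{m},$$ where $$C_{n,m}=\frac{\alpha_{m+1}M_n}{1-r_n},\qquad \alpha_j=\frac{(2j-3)!!}{2\,(2j)!!}\quad(j\ge1),\qquad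 (-1)!!:=1.$$
   Context: Problem. $\delta$ is the Dirac delta function. A pair $(\lambda,u)$ solves the problem if $u\in C[0,1]$, $u'$ is absolutely continuous on each side of $\alpha$ (up to $\alpha$ and the endpoints), $u''-q u+\lambda u=0$ holds almost everywhere on $(0,1)\setminus\{\alpha\}$, $u(0)=u(1)=0$, $u'(0)=1$, and $u'(\alpha+0)-u'(\alpha-0)=\beta u(\alpha)$. This jump condition is the meaning of the delta term. Norms. $\|v\|_\infty=\max_{x\in[0,1]}|v(x)|$ and $\|q\|_{0,1}=\int_0^1|q(x)|\,dx$. Also $(2k)!!=2\cdot4\cdots(2k)$ and $(2k+1)!!=1\cdot3\cdots(2k+1)$. Basic (unperturbed) eigenpair. $\lambda_n^{(0)}$ is the unique root in $[\pi^2n^2,\pi^2(n+1)^2)$ of $$\sqrt{\lambda}\sin(\sqrt{\lambda})=-\beta\sin(\sqrt{\lambda}\,\alpha)\sin(\sqrt{\lambda}(1-\alpha)),$$ and $s_n=\sqrt{\lambda_n^{(0)}}$. Set $$c_n^{(0)}=\frac{\sin(s_n\alpha)}{s_n\sin(s_n(1-\alpha))}\ \text{ if }\sin(s_n(1-\alpha))\ne0,\qquad c_n^{(0)}=-\frac{\cos s_n}{s_n}\ \text{ otherwise},$$ $$u_n^{(0)}(x)=\frac{\sin(s_nx)}{s_n}\ (0\le x\le\alpha),\qquad u_n^{(0)}(x)=c_n^{(0)}\sin(s_n(1-x))\ (\alpha<x\le1).$$ Corrections of the FD-method. For $j\ge1$, recursively, $$\lambda_n^{(j)}=\frac{\lambda_n^{(0)}}{M_n}\Bigl(-\sum_{p=1}^{j-1}\lambda_n^{(j-p)}\int_0^1u_n^{(0)}u_n^{(p)}\,d\xi+\int_0^1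 q\,u_n^{(j-1)}u_n^{(0)}\,d\xi\Bigr),$$ $$F_n^{(j)}(x)=-\sum_{p=0}^{j-1}\lambda_n^{(j-p)}u_n^{(p)}(x)+q(x)u_n^{(j-1)}(x),$$ $$u_n^{(j)}(x)=\int_0^x\frac{\sin(s_n(x-\xi))}{s_n}F_n^{(j)}(\xi)\,d\xi\quad(0\le x\le\alpha),$$ $$u_n^{(j)}(x)=c_n^{(j)}\sin(s_n(1-x))-\int_x^1\frac{\sin(s_n(x-\xi))}{s_n}F_n^{(j)}(\xi)\,d\xi\quad(\alpha\le x\le1),$$ where the number $c_n^{(j)}$ is determined by the two (mutually compatible) equations $$c_n^{(j)}\sin(s_n(1-\alpha))=\int_0^1\frac{\sin(s_n(\alpha-\xi))}{s_n}F_n^{(j)}(\xi)\,d\xi,$$ $$c_n^{(j)}\cos(s_n(1-\alpha))=-\int_0^1\frac{\cos(s_n(\alpha-\xi))}{s_n}F_n^{(j)}(\xi)\,d\xi-\beta\int_0^\alpha\frac{\sin(s_n(\alpha-\xi))}{\lambda_n^{(0)}}F_n^{(j)}(\xi)\,d\xi.$$ Constants. $$\widetilde c_n=\sin^2(s_n\alpha)+\Bigl(\cos(s_n\alpha)+\frac{\beta}{s_n}\sin(s_n\alpha)\Bigr)^2=\lambda_n^{(0)}\bigl(c_n^{(0)}\bigr)^2,$$ $$M_n=\lambda_n^{(0)}\int_0^1\bigl(u_n^{(0)}\bigr)^2d\xi=\frac12\Bigl(1+\Bigl[\frac{\beta\sin(2s_n\alpha)}{s_n}+\frac{\beta^2\sin^2(s_n\alpha)}{\lambda_n^{(0)}}\Bigr](1-\alpha)+\frac{\beta\sin^2(s_n\alpha)}{\lambda_n^{(0)}}\Bigr),$$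 $$b_n=\max\Bigl\{1,\frac{s_n}{M_n},\frac{s_n\sqrt{\widetilde c_n}}{M_n}\Bigr\},\qquad \overline v_0=b_n\|u_n^{(0)}\|_\infty,$$ $$R=\frac{1+2\overline v_0-2\sqrt{\overline v_0(1+\overline v_0)}}{(1+\overline v_0)\|q\|_{0,1}},\qquad r_n=\frac{1+\sqrt{1+(1+\beta/s_n)^2}}{s_nR}.$$ If $\|q\|_{0,1}=0$, read $1/R=0$ and $r_n=0$. *)

theory Defs
  imports "HOL-Analysis.Analysis"
begin

definition abs_continuous_on :: "real \<Rightarrow> real \<Rightarrow> (real \<Rightarrow> real) \<Rightarrow> bool" where
  "abs_continuous_on a b f \<longleftrightarrow>
     (\<forall>e>0. \<exists>d>0. \<forall>D T. D division_of T \<longrightarrow> T \<subseteq> {a..b} \<longrightarrow> (\<Sum>K\<in>D. Sup K - Inf K) < d \<longrightarrow>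
        (\<Sum>K\<in>D. \<bar>f (Sup K) - f (Inf K)\<bar>) < e)"

(* \<open>v\<close> and \<open>w\<close> are \<open>u'\<close> on the two closed intervals adjacent to \<open>\<alpha>\<close>, with one-sided
   derivatives at the ends; hence \<open>v 0 = u'(0)\<close>, \<open>v \<alpha> = u'(\<alpha>-0)\<close> and \<open>w \<alpha> = u'(\<alpha>+0)\<close>. *)
definition is_solution ::
  "real \<Rightarrow> real \<Rightarrow> (real \<Rightarrow> real) \<Rightarrow> real \<Rightarrow> (real \<Rightarrow> real) \<Rightarrow> bool" where
  "is_solution \<alpha> \<beta> q lam u \<longleftrightarrow>
     continuous_on {0..1} u \<and>
     (\<exists>v w.
        (\<forall>x\<in>{0..\<alpha>}. (u has_real_derivative v x) (at x within {0..\<alpha>})) \<and>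
        (\<forall>x\<in>{\<alpha>..1}. (u has_real_derivative w x) (at x within {\<alpha>..1})) \<and>
        abs_continuous_on 0 \<alpha> v \<and> abs_continuous_on \<alpha> 1 w \<and>
        (AE x in lebesgue. x \<in> {0<..<\<alpha>} \<longrightarrow>
           (\<exists>u''. (v has_real_derivative u'') (at x) \<and> u'' - q x * u x + lam * u x = 0)) \<and>
        (AE x in lebesgue. x \<in> {\<alpha><..<1} \<longrightarrow>
           (\<exists>u''. (w has_real_derivative u'') (at x) \<and> u'' - q x * u x + lam * u x = 0)) \<and>
        u 0 = 0 \<and> u 1 = 0 \<and> v 0 = 1 \<and>
        w \<alpha> - v \<alpha> = \<beta> * u \<alpha>)"

(* For \<open>v\<close> continuous on \<open>[0,1]\<close> the supremum is attained. *)
definition norm_inf :: "(real \<Rightarrow> real) \<Rightarrow> real" where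
  "norm_inf v = (SUP x\<in>{0..1}. \<bar>v x\<bar>)"

definition norm_L1 :: "(real \<Rightarrow> real) \<Rightarrow> real" where
  "norm_L1 q = integral {0..1} (\<lambda>x. \<bar>q x\<bar>)"

(* Note \<open>dfact 0 = 1\<close>; with truncated subtraction \<open>dfact (2 * 1 - 3) = 1\<close>, which is the
   convention \<open>(-1)!! = 1\<close>. *)
fun dfact :: "nat \<Rightarrow> nat" where
  "dfact 0 = 1"
| "dfact (Suc 0) = 1"
| "dfact (Suc (Suc k)) = Suc (Suc k) * dfact k"

definition fd_alpha :: "nat \<Rightarrow> real" where
  "fd_alpha j = real (dfact (2 * j - 3)) / (2 * real (dfact (2 * j)))"

context
  fixes \<alpha> \<beta> :: real and q :: "real \<Rightarrow> real" and n :: nat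
begin

definition fd_lam0 :: real where
  "fd_lam0 = (THE lam. pi\<^sup>2 * (real n)\<^sup>2 \<le> lam \<and> lam < pi\<^sup>2 * (real n + 1)\<^sup>2 \<and>
     sqrt lam * sin (sqrt lam) = - \<beta> * sin (sqrt lam * \<alpha>) * sin (sqrt lam * (1 - \<alpha>)))"

definition fd_s :: real where
  "fd_s = sqrt fd_lam0"

definition fd_c0 :: real where
  "fd_c0 = (if sin (fd_s * (1 - \<alpha>)) \<noteq> 0
            then sin (fd_s * \<alpha>) / (fd_s * sin (fd_s * (1 - \<alpha>)))
            else - cos fd_s / fd_s)"

definition fd_u0 :: "real \<Rightarrow> real" where
  "fd_u0 x = (if x \<le> \<alpha> then sin (fd_s * x) / fd_s else fd_c0 * sin (fd_s * (1 - x)))"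

definition fd_M :: real where
  "fd_M = fd_lam0 * integral {0..1} (\<lambda>\<xi>. (fd_u0 \<xi>)\<^sup>2)"

(* At \<open>x = \<alpha>\<close> both branches of \<open>fd_u\<close> agree, by the first equation determining \<open>fd_c\<close>.
   The value \<open>fd_F 0\<close> is a dummy. *)
function (sequential)
    fd_lam :: "nat \<Rightarrow> real"
and fd_F :: "nat \<Rightarrow> real \<Rightarrow> real"
and fd_c :: "nat \<Rightarrow> real"
and fd_u :: "nat \<Rightarrow> real \<Rightarrow> real"
where
  "fd_lam 0 = fd_lam0"
| "fd_lam (Suc k) = fd_lam0 / fd_M *
     (- (\<Sum>p=1..k. fd_lam (Suc k - p) * integral {0..1} (\<lambda>\<xi>. fd_u0 \<xi> * fd_u p \<xi>))
      + integral {0..1} (\<lambda>\<xi>. q \<xi> * fd_u k \<xi> * fd_u0 \<xi>))"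
| "fd_F 0 x = 0"
| "fd_F (Suc k) x = - (\<Sum>p=0..k. fd_lam (Suc k - p) * fd_u p x) + q x * fd_u k x"
| "fd_c 0 = fd_c0"
| "fd_c (Suc k) = (THE c.
     c * sin (fd_s * (1 - \<alpha>))
       = integral {0..1} (\<lambda>\<xi>. sin (fd_s * (\<alpha> - \<xi>)) / fd_s * fd_F (Suc k) \<xi>) \<and>
     c * cos (fd_s * (1 - \<alpha>))
       = - integral {0..1} (\<lambda>\<xi>. cos (fd_s * (\<alpha> - \<xi>)) / fd_s * fd_F (Suc k) \<xi>)
         - \<beta> * integral {0..\<alpha>} (\<lambda>\<xi>. sin (fd_s * (\<alpha> - \<xi>)) / fd_lam0 * fd_F (Suc k) \<xi>))"
| "fd_u 0 x = fd_u0 x"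
| "fd_u (Suc k) x =
     (if x \<le> \<alpha>
      then integral {0..x} (\<lambda>\<xi>. sin (fd_s * (x - \<xi>)) / fd_s * fd_F (Suc k) \<xi>)
      else fd_c (Suc k) * sin (fd_s * (1 - x))
           - integral {x..1} (\<lambda>\<xi>. sin (fd_s * (x - \<xi>)) / fd_s * fd_F (Suc k) \<xi>))"
  by pat_completeness auto
termination
  by (relation "Wellfounded.measure (\<lambda>z. case z of
        Inl (Inl j) \<Rightarrow> 4 * j | Inl (Inr (j, _)) \<Rightarrow> 4 * j + 1
      | Inr (Inl j) \<Rightarrow> 4 * j + 2 | Inr (Inr (j, _)) \<Rightarrow> 4 * j + 3)") auto

definition fd_ctilde :: real where
  "fd_ctilde = (sin (fd_s * \<alpha>))\<^sup>2 + (cos (fd_s * \<alpha>) + \<beta> / fd_s * sin (fd_s * \<alpha>))\<^sup>2"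

definition fd_b :: real where
  "fd_b = Max {1, fd_s / fd_M, fd_s * sqrt fd_ctilde / fd_M}"

definition fd_v0 :: real where
  "fd_v0 = fd_b * norm_inf fd_u0"

(* If \<open>norm_L1 q = 0\<close>, then \<open>fd_R = 0\<close> because \<open>x / 0 = 0\<close>; hence \<open>1 / fd_R = 0\<close> and
   \<open>fd_r = 0\<close>, which is the intended reading of this degenerate case. *)
definition fd_R :: real where
  "fd_R = (1 + 2 * fd_v0 - 2 * sqrt (fd_v0 * (1 + fd_v0))) / ((1 + fd_v0) * norm_L1 q)"

definition fd_r :: real where
  "fd_r = (1 + sqrt (1 + (1 + \<beta> / fd_s)\<^sup>2)) / (fd_s * fd_R)"

definition fd_C :: "nat \<Rightarrow> real" where
  "fd_C m = fd_alpha (m + 1) * fd_M / (1 - fd_r)"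

end

end

theory Submission
  imports Defs "HOL-Computational_Algebra.Formal_Power_Series"
begin

text \<open>
  The choice of \<open>lam (k + 1)\<close> makes the right-hand side \<open>F (k + 1)\<close> orthogonal to \<open>u 0\<close>, which is the solvability
  condition of the boundary value problem for \<open>u (k + 1)\<close>; hence \<open>u (k + 1)\<close> is also the solution of the
  initial value problem with zero data at 0 and depends boundedly on the \<open>L\<^sub>1\<close> norm of \<open>F (k + 1)\<close>.
  The resulting recursive inequalities for the norms are majorized by a sequence whose generating
  function solves a quadratic equation; its coefficients are read off the binomial series of the
  square root and are bounded by \<open>fd_alpha j / \<rho> ^ j\<close>. This yields geometric convergence. Summing the
  equations for the corrections gives an integral equation for the limit, and the differential
  equation follows from Lebesgue's differentiation theorem.
\<close>

section \<open>Indefinite integrals of integrable functions\<close>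

text \<open>Since q is merely integrable, second derivatives exist only almost everywhere, and the
  partial sums of the right-hand sides have only an integrable majorant. So no series is
  differentiated term by term: integral equations are summed by dominated convergence, and their
  limit is differentiated. The two-branch definition of the corrections contains a constant fixed by
  two equations and is unsuited to estimates; the initial value form contains no such constant.

  Origin of the constants: \<open>fd_b\<close> bounds the factor lam0 / M * |u0| of the eigenvalue
  recursion. Once the norms of the corrections are multiplied by it, both recursions take one
  quadratic shape with starting value \<open>fd_v0\<close>. The right-hand side for
  \<open>u (k + 1)\<close> contains \<open>lam (k + 1)\<close> times \<open>u 0\<close>, which
  accounts for the factor 1 + \<open>fd_v0\<close> in \<open>fd_R\<close>. The numerator of
  \<open>fd_R\<close> is the smaller zero of the discriminant of the quadratic equation for the
  generating function, and \<open>fd_r\<close> is the growth factor of the recursion divided by that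
  zero.\<close>

lemma AE_has_derivative_indefinite_integral:
  fixes f :: "real \<Rightarrow> real"
  assumes f: "f integrable_on {a..b}"
  shows "AE x in lebesgue. x \<in> {a<..<b} \<longrightarrow>
    ((\<lambda>x. integral {a..x} f) has_real_derivative f x) (at x)"
proof -
  define \<Phi> where "\<Phi> x = integral {a..x} f" for x
  \<comment> \<open>Points at which the difference quotient of \<open>\<Phi>\<close> misses
    \<open>f x\<close> by at least \<open>\<mu>\<close> at arbitrarily small scales. A point where
    the derivative is not \<open>f x\<close> lies in \<open>E (1 / Suc k)\<close> for some k, so it
    suffices that each of these sets is negligible.\<close>
  define E where "E \<mu> = {x\<in>{a<..<b}. \<forall>d>0. \<exists>y\<in>{a<..<b}. y \<noteq> x \<and> \<bar>y - x\<bar> < d \<and>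
    \<mu> * \<bar>y - x\<bar> \<le> \<bar>\<Phi> y - \<Phi> x - f x * (y - x)\<bar>}" for \<mu>
  have incr: "\<bar>(max x y - min x y) * f x - integral {min x y..max x y} f\<bar> = \<bar>\<Phi> y - \<Phi> x - f x * (y - x)\<bar>"
    if "x \<in> {a<..<b}" "y \<in> {a<..<b}" for x y
  proof -
    have *: "integral {min x y..max x y} f = \<Phi> (max x y) - \<Phi> (min x y)"
    proof -
      have "f integrable_on {a..max x y}"
        by (rule integrable_subinterval_real[OF f]) (use that in auto)
      then have "integral {a..min x y} f + integral {min x y..max x y} f = integral {a..max x y} f"
        by (rule Henstock_Kurzweil_Integration.integral_combine[rotated -1]) (use that in auto)
      then show ?thesis by (simp add: \<Phi>_def)
    qed
    show ?thesis unfolding * by (cases "x \<le> y") (auto simp: algebra_simps abs_if min_def max_def)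
  qed
  have negl: "negligible (E \<mu>)" if "\<mu> > 0" for \<mu>
    unfolding negligible_outer_le
  proof (intro allI impI)
    fix e :: real assume "e > 0"
    \<comment> \<open>A bad interval contributes at least \<open>\<mu>\<close> times its length to
      the Henstock sum, so the tolerance \<open>\<mu> * e\<close> caps the total length by
      e.\<close>
    obtain \<gamma> where \<gamma>: "gauge \<gamma>"
      and hen: "\<And>p. \<lbrakk>p tagged_partial_division_of (cbox a b); \<gamma> fine p\<rbrakk> \<Longrightarrow>
         (\<Sum>(x,k)\<in>p. norm (measure lborel k *\<^sub>R f x - integral k f)) < \<mu> * e"
      using Henstock_lemma[of f a b "\<mu> * e"] f \<open>e > 0\<close> \<open>\<mu> > 0\<close> by auto
    define K where "K = {(x,y). x \<in> {a<..<b} \<and> y \<in> {a<..<b} \<and> y \<noteq> x \<and>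
       {min x y..max x y} \<subseteq> \<gamma> x \<and> \<mu> * \<bar>y - x\<bar> \<le> \<bar>\<Phi> y - \<Phi> x - f x * (y - x)\<bar>}"
    define c where "c = (\<lambda>(x,y). (x + y) / 2 :: real)"
    define r where "r = (\<lambda>(x,y). \<bar>y - x\<bar> / 2 :: real)"
    have cb: "cball (c i) (r i) = {min (fst i) (snd i)..max (fst i) (snd i)}" for i
      by (cases i) (auto simp: c_def r_def cball_eq_atLeastAtMost min_def max_def abs_if field_simps)
    txt \<open>A disjoint subfamily of the bad intervals is a \<open>\<gamma>\<close>-fine tagged partial division, so Henstock's
      lemma bounds its total length.\<close>
    obtain C where C: "countable C" "C \<subseteq> K"
      "pairwise (\<lambda>i j. disjnt (cball (c i) (r i)) (cball (c j) (r j))) C"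
      "negligible (E \<mu> - (\<Union>i \<in> C. cball (c i) (r i)))"
    proof (rule Vitali_covering_theorem_cballs[of K r "E \<mu>" c])
      show "0 < r i" if "i \<in> K" for i using that by (auto simp: K_def r_def)
      fix x d :: real assume x: "x \<in> E \<mu>" and "0 < d"
      obtain h where h: "h > 0" "ball x h \<subseteq> \<gamma> x"
        using \<gamma> unfolding gauge_def by (meson openE)
      obtain y where y: "y\<in>{a<..<b}" "y \<noteq> x" "\<bar>y - x\<bar> < min h d"
         "\<mu> * \<bar>y - x\<bar> \<le> \<bar>\<Phi> y - \<Phi> x - f x * (y - x)\<bar>"
        using x \<open>0 < d\<close> h unfolding E_def by (smt (verit, best) mem_Collect_eq)
      have "{min x y..max x y} \<subseteq> ball x h"
        using y by (auto simp: dist_real_def min_def max_def split: if_splits)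
      then have "(x,y) \<in> K" using y h x by (auto simp: K_def E_def)
      moreover have "x \<in> cball (c (x,y)) (r (x,y))" unfolding cb by auto
      moreover have "r (x,y) < d" using y by (auto simp: r_def)
      ultimately show "\<exists>i. i \<in> K \<and> x \<in> cball (c i) (r i) \<and> r i < d" by blast
    qed
    define U where "U = (\<Union>i \<in> C. cball (c i) (r i))"
    \<comment> \<open>Henstock's lemma concerns finite partial divisions, so the bound is shown for
      finite subfamilies and then passed to the countable union.\<close>
    have bound: "measure lebesgue (\<Union>i \<in> C'. cball (c i) (r i)) \<le> e" if C': "C' \<subseteq> C" "finite C'" for C'
    proof -
      define k where "k i = {min (fst i) (snd i)..max (fst i) (snd i)}" for i :: "real \<times> real"
      define p where "p = (\<lambda>i. (fst i, k i)) ` C'"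
      have disj: "k i \<inter> k j = {}" if "i \<in> C'" "j \<in> C'" "i \<noteq> j" for i j
        using C(3) that C' unfolding pairwise_def cb disjnt_def k_def by blast
      have ne: "k i \<noteq> {}" for i unfolding k_def by auto
      have inj: "inj_on (\<lambda>i. (fst i, k i)) C'"
        by (rule inj_onI) (metis disj ne Int_absorb prod.inject)
      have KC: "i \<in> K" if "i \<in> C'" for i using that C C' by blast
      have part: "p tagged_partial_division_of (cbox a b)"
        unfolding tagged_partial_division_of_def
      proof (intro conjI allI impI)
        show "finite p" using C' by (simp add: p_def)
        fix x k1 assume "(x,k1) \<in> p"
        then obtain i where i: "i \<in> C'" "x = fst i" "k1 = k i" by (auto simp: p_def)
        show "x \<in> k1" using i by (auto simp: k_def)
        show "k1 \<subseteq> cbox a b" using i KC[OF i(1)] by (auto simp: k_def K_def)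
        show "\<exists>a b. k1 = cbox a b" using i by (auto simp: k_def)
      next
        fix x1 k1 x2 k2 assume *: "(x1,k1) \<in> p \<and> (x2,k2) \<in> p \<and> (x1,k1) \<noteq> (x2,k2)"
        then obtain i j where "i \<in> C'" "k1 = k i" "j \<in> C'" "k2 = k j" "i \<noteq> j"
          by (auto simp: p_def)
        then have "k1 \<inter> k2 = {}" using disj by blast
        then show "interior k1 \<inter> interior k2 = {}"
          using interior_subset by blast
      qed
      have "k i \<subseteq> \<gamma> (fst i)" if "i \<in> C'" for i
        using KC[OF that] by (cases i) (simp add: K_def k_def)
      then have fine: "\<gamma> fine p" unfolding fine_def p_def by blast
      have meas: "measure lebesgue (cball (c i) (r i)) = \<bar>snd i - fst i\<bar>" for i
        unfolding cb by (auto simp: min_def max_def)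
      have "measure lebesgue (\<Union>i \<in> C'. cball (c i) (r i)) \<le> (\<Sum>i\<in>C'. \<bar>snd i - fst i\<bar>)"
        using measure_UNION_le[OF \<open>finite C'\<close>, of "\<lambda>i. cball (c i) (r i)" lebesgue] by (simp add: meas)
      also have "\<dots> \<le> (\<Sum>i\<in>C'. norm (measure lborel (k i) *\<^sub>R f (fst i) - integral (k i) f) / \<mu>)"
      proof (rule sum_mono)
        fix i assume "i \<in> C'"
        obtain x y where xy: "i = (x,y)" by fastforce
        have *: "x \<in> {a<..<b}" "y \<in> {a<..<b}" "\<mu> * \<bar>y - x\<bar> \<le> \<bar>\<Phi> y - \<Phi> x - f x * (y - x)\<bar>"
          using KC[OF \<open>i \<in> C'\<close>] xy by (auto simp: K_def)
        have "norm (measure lborel (k i) *\<^sub>R f (fst i) - integral (k i) f) = \<bar>\<Phi> y - \<Phi> x - f x * (y - x)\<bar>"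
          using incr[OF *(1,2)] by (simp add: k_def xy min.coboundedI1)
        then show "\<bar>snd i - fst i\<bar> \<le> norm (measure lborel (k i) *\<^sub>R f (fst i) - integral (k i) f) / \<mu>"
          using * \<open>\<mu> > 0\<close> by (simp add: xy field_simps)
      qed
      also have "\<dots> = (\<Sum>i\<in>C'. norm (measure lborel (k i) *\<^sub>R f (fst i) - integral (k i) f)) / \<mu>"
        by (simp add: sum_divide_distrib)
      also have "(\<Sum>i\<in>C'. norm (measure lborel (k i) *\<^sub>R f (fst i) - integral (k i) f)) =
         (\<Sum>(x,k)\<in>p. norm (measure lborel k *\<^sub>R f x - integral k f))"
        unfolding p_def by (subst sum.reindex[OF inj]) (simp add: o_def)
      also have "\<dots> / \<mu> \<le> e" using hen[OF part fine] \<open>\<mu> > 0\<close> by (simp add: field_simps)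
      finally show ?thesis .
    qed
    have U: "U \<in> lmeasurable" "measure lebesgue U \<le> e"
      unfolding U_def
      using fmeasurable_UN_bound[OF C(1), of "\<lambda>i. cball (c i) (r i)" lebesgue e]
       measure_UN_bound[OF C(1), of "\<lambda>i. cball (c i) (r i)" lebesgue e] bound by auto
    have N: "E \<mu> - U \<in> lmeasurable" "measure lebesgue (E \<mu> - U) = 0"
      using C(4) unfolding U_def by (auto simp: negligible_imp_measurable negligible_imp_measure0)
    have "measure lebesgue (U \<union> (E \<mu> - U)) \<le> e"
      using measure_Un_le[of U lebesgue "E \<mu> - U"] U N by (auto simp: fmeasurableD)
    then show "\<exists>T. E \<mu> \<subseteq> T \<and> T \<in> lmeasurable \<and> measure lebesgue T \<le> e"
      by (intro exI[of _ "U \<union> (E \<mu> - U)"] conjI fmeasurable.Un[OF U(1) N(1)]) blast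
  qed
  have "negligible (\<Union>k. E (1 / Suc k))"
    by (intro negligible_countable_Union) (auto intro: negl)
  then have "(\<Union>k. E (1 / Suc k)) \<in> null_sets lebesgue"
    by (simp add: negligible_iff_null_sets)
  moreover have "x \<in> (\<Union>k. E (1 / Suc k))"
    if x: "x \<in> {a<..<b}" and nd: "\<not> ((\<lambda>x. integral {a..x} f) has_real_derivative f x) (at x)" for x
    proof (rule ccontr)
      assume not: "x \<notin> (\<Union>k. E (1 / Suc k))"
      have "((\<lambda>y. (\<Phi> y - \<Phi> x) / (y - x)) \<longlongrightarrow> f x) (at x)"
      proof (rule tendstoI)
        fix e :: real assume "e > 0"
        then obtain k where k: "1 / Suc k < e" by (metis nat_approx_posE)
        have "x \<notin> E (1 / Suc k)" using not by blast
        then have "\<exists>d>0. \<forall>y\<in>{a<..<b}. y \<noteq> x \<longrightarrow> \<bar>y - x\<bar> < d \<longrightarrow>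
             \<bar>\<Phi> y - \<Phi> x - f x * (y - x)\<bar> < 1 / Suc k * \<bar>y - x\<bar>"
          using x unfolding E_def by (simp add: not_le) blast
        then obtain d where d: "d > 0" and D: "\<And>y. y\<in>{a<..<b} \<Longrightarrow> y \<noteq> x \<Longrightarrow> \<bar>y - x\<bar> < d \<Longrightarrow>
             \<bar>\<Phi> y - \<Phi> x - f x * (y - x)\<bar> < 1 / Suc k * \<bar>y - x\<bar>"
          by blast
        show "\<forall>\<^sub>F y in at x. dist ((\<Phi> y - \<Phi> x) / (y - x)) (f x) < e"
          unfolding eventually_at
        proof (intro exI conjI ballI impI)
          show "min d (min (x - a) (b - x)) > 0" using d x by auto
          fix y assume y: "y \<noteq> x \<and> dist y x < min d (min (x - a) (b - x))"
          then have "\<bar>\<Phi> y - \<Phi> x - f x * (y - x)\<bar> < 1 / Suc k * \<bar>y - x\<bar>"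
            by (intro D) (auto simp: dist_real_def abs_if split: if_splits)
          moreover have "dist ((\<Phi> y - \<Phi> x) / (y - x)) (f x) = \<bar>\<Phi> y - \<Phi> x - f x * (y - x)\<bar> / \<bar>y - x\<bar>"
            
            using y by (simp only: dist_real_def flip: abs_divide) (simp add: diff_divide_distrib)
          ultimately show "dist ((\<Phi> y - \<Phi> x) / (y - x)) (f x) < e"
            using y k by (smt (verit, best) pos_divide_less_eq)
        qed
      qed
      then show False using nd unfolding has_field_derivative_iff \<Phi>_def by simp
    qed
  ultimately show ?thesis by (intro AE_I'[of "\<Union>k. E (1 / Suc k)"]) blast+
qed

lemma AE_has_derivative_if_integral:
  fixes v f :: "real \<Rightarrow> real"
  assumes f: "f absolutely_integrable_on {l..h}" and v: "\<And>x. x \<in> {l..h} \<Longrightarrow> v x = v l + integral {l..x} f"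
  shows "AE x in lebesgue. x \<in> {l<..<h} \<longrightarrow> (v has_real_derivative f x) (at x)"
  using AE_has_derivative_indefinite_integral[OF set_lebesgue_integral_eq_integral(1)[OF f]]
proof (rule AE_mp, intro AE_I2 impI)
  fix x assume x: "x \<in> {l<..<h}" and "x \<in> {l<..<h} \<longrightarrow> ((\<lambda>x. integral {l..x} f) has_real_derivative f x) (at x)"
  then have "((\<lambda>x. v l + integral {l..x} f) has_real_derivative 0 + f x) (at x)"
    by (intro DERIV_add) auto
  then show "(v has_real_derivative f x) (at x)"
    unfolding add_0
  proof (rule has_field_derivative_transform_within_open[OF _ open_greaterThanLessThan x])
    show "v l + integral {l..y} f = v y" if "y \<in> {l<..<h}" for y
      using that by (intro v[symmetric]) simp
  qed
qed

lemma absolutely_integrable_continuous_mult: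
  fixes f g :: "real \<Rightarrow> real"
  assumes "continuous_on {a..b} g" "f absolutely_integrable_on {a..b}"
  shows "(\<lambda>x. g x * f x) absolutely_integrable_on {a..b}"
proof (rule absolutely_integrable_bounded_measurable_product_real)
  show "g \<in> borel_measurable (lebesgue_on {a..b})"
    by (rule continuous_imp_measurable_on_sets_lebesgue[OF assms(1)]) simp
  show "bounded (g ` {a..b})"
    using assms(1) by (simp add: compact_continuous_image compact_imp_bounded)
qed (use assms in auto)

lemma absolutely_integrable_on_subinterval:
  fixes f :: "real \<Rightarrow> real"
  assumes "f absolutely_integrable_on S" "{c..d} \<subseteq> S"
  shows "f absolutely_integrable_on {c..d}"
  by (rule set_integrable_subset[OF assms(1)]) (use assms(2) in auto)

text \<open>Truncation: for large N the excess \<open>h\<close> of |f| over min |f| N has integral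
  below e / 2, whatever the intervals are. The truncated part contributes at most N times their
  total length.\<close>

lemma abs_continuous_on_indefinite_integral:
  fixes f :: "real \<Rightarrow> real"
  assumes f: "f absolutely_integrable_on {a..b}"
    and v: "\<And>x. x \<in> {a..b} \<Longrightarrow> v x = v a + integral {a..x} f"
  shows "abs_continuous_on a b v"
  unfolding abs_continuous_on_def
proof (intro allI impI)
  fix e :: real assume e: "e > 0"
  have fa: "(\<lambda>x. \<bar>f x\<bar>) absolutely_integrable_on {a..b}"
    using f by (rule set_integrable_abs)
  have g: "(\<lambda>x. min \<bar>f x\<bar> (real k)) absolutely_integrable_on {a..b}" for k
    by (intro absolutely_integrable_min_1 fa) (simp add: absolutely_integrable_continuous_real)
  have "(\<lambda>k. integral {a..b} (\<lambda>x. min \<bar>f x\<bar> (real k))) \<longlonglongrightarrow> integral {a..b} (\<lambda>x. \<bar>f x\<bar>)"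
  proof (rule dominated_convergence(2)[where h = "\<lambda>x. \<bar>f x\<bar>"])
    fix x
    obtain n :: nat where "\<bar>f x\<bar> \<le> real n" using real_arch_simple by blast
    then have "\<forall>\<^sub>F k in sequentially. min \<bar>f x\<bar> (real k) = \<bar>f x\<bar>"
      by (auto simp: eventually_sequentially intro!: exI[of _ n])
    then show "(\<lambda>k. min \<bar>f x\<bar> (real k)) \<longlonglongrightarrow> \<bar>f x\<bar>" by (rule tendsto_eventually)
  qed (use g fa in \<open>auto simp: set_lebesgue_integral_eq_integral(1)\<close>)
  from tendstoD[OF this, of "e / 2"] e
  obtain N where N: "\<bar>integral {a..b} (\<lambda>x. min \<bar>f x\<bar> (real N)) - integral {a..b} (\<lambda>x. \<bar>f x\<bar>)\<bar> < e / 2"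
    by (auto simp: dist_real_def eventually_sequentially)
  define h where "h x = \<bar>f x\<bar> - min \<bar>f x\<bar> (real N)" for x
  have h: "h absolutely_integrable_on {a..b}" unfolding h_def
    by (rule set_integral_diff(1)[OF fa g])
  have h0: "h x \<ge> 0" for x by (simp add: h_def)
  have he: "integral {a..b} h < e / 2"
  proof -
    have "integral {a..b} h = integral {a..b} (\<lambda>x. \<bar>f x\<bar>) - integral {a..b} (\<lambda>x. min \<bar>f x\<bar> (real N))"
      unfolding h_def using fa g by (intro integral_diff) (auto simp: set_lebesgue_integral_eq_integral(1))
    then show ?thesis using N by linarith
  qed
  show "\<exists>d>0. \<forall>D T. D division_of T \<longrightarrow> T \<subseteq> {a..b} \<longrightarrow> (\<Sum>K\<in>D. Sup K - Inf K) < d \<longrightarrow>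
        (\<Sum>K\<in>D. \<bar>v (Sup K) - v (Inf K)\<bar>) < e"
  proof (intro exI conjI allI impI)
    \<comment> \<open>N + 1 instead of N because N may be 0.\<close>
    show "e / (2 * (real N + 1)) > 0" using e by simp
    fix D T assume D: "D division_of T" and T: "T \<subseteq> {a..b}"
      and small: "(\<Sum>K\<in>D. Sup K - Inf K) < e / (2 * (real N + 1))"
    have each: "\<bar>v (Sup K) - v (Inf K)\<bar> \<le> integral K h + real N * (Sup K - Inf K) \<and> Inf K \<le> Sup K" if "K \<in> D" for K
    proof -
      obtain c d where "K = cbox c d" "K \<noteq> {}" "K \<subseteq> {a..b}"
        using division_ofD(2-4)[OF D \<open>K \<in> D\<close>] T by blast
      then have K: "K = {c..d}" "c \<le> d" "a \<le> c" "d \<le> b" by auto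
      have fK: "f absolutely_integrable_on K" and hK: "h absolutely_integrable_on K"
        using f h K by (auto intro: absolutely_integrable_on_subinterval)
      have "integral {a..c} f + integral {c..d} f = integral {a..d} f"
        using K f by (intro Henstock_Kurzweil_Integration.integral_combine)
         (auto intro!: set_lebesgue_integral_eq_integral(1) absolutely_integrable_on_subinterval[OF f])
      then have "v d - v c = integral K f" using v[of c] v[of d] K by simp
      also have "\<bar>\<dots>\<bar> \<le> integral K (\<lambda>x. h x + real N)"
      proof -
        have "norm (integral K f) \<le> integral K (\<lambda>x. h x + real N)"
        proof (rule integral_norm_bound_integral)
          show "(\<lambda>x. h x + real N) integrable_on K"
            using hK K by (intro integrable_add) (auto simp: set_lebesgue_integral_eq_integral(1))
        qed (use fK in \<open>auto simp: set_lebesgue_integral_eq_integral(1) h_def\<close>)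
        then show ?thesis by simp
      qed
      also have "\<dots> = integral K h + real N * (d - c)"
        using hK K by (subst Henstock_Kurzweil_Integration.integral_add) (auto simp: set_lebesgue_integral_eq_integral(1))
      finally show ?thesis using K by simp
    qed
    have "(\<Sum>K\<in>D. \<bar>v (Sup K) - v (Inf K)\<bar>) \<le> (\<Sum>K\<in>D. integral K h + real N * (Sup K - Inf K))"
      by (rule sum_mono) (use each in blast)
    also have "\<dots> = (\<Sum>K\<in>D. integral K h) + real N * (\<Sum>K\<in>D. Sup K - Inf K)"
      by (simp add: sum.distrib sum_distrib_left)
    also have "(\<Sum>K\<in>D. integral K h) \<le> integral {a..b} h"
    proof -
      have hT: "h integrable_on T"
        by (intro set_lebesgue_integral_eq_integral(1) set_integrable_subset[OF h] T fmeasurableD lmeasurable_division[OF D])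
      have "(\<Sum>K\<in>D. integral K h) = integral T h"
        using integral_combine_division_topdown[OF hT D] by simp
      also have "\<dots> \<le> integral {a..b} h"
        using T hT h h0 by (intro integral_subset_le) (auto simp: set_lebesgue_integral_eq_integral(1))
      finally show ?thesis .
    qed
    also have "integral {a..b} h + real N * (\<Sum>K\<in>D. Sup K - Inf K) < e"
    proof -
      have "real N * (\<Sum>K\<in>D. Sup K - Inf K) \<le> real N * (e / (2 * (real N + 1)))"
        using small by (intro mult_left_mono) auto
      also have "\<dots> \<le> e / 2" using e by (simp add: field_simps)
      finally show ?thesis using he by linarith
    qed
    finally show "(\<Sum>K\<in>D. \<bar>v (Sup K) - v (Inf K)\<bar>) < e" by simp
  qed
qed

section \<open>Integration by parts with an integrable factor, and Duhamel's formula\<close>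

lemma integral_mult_by_parts:
  fixes f g g' :: "real \<Rightarrow> real"
  assumes f: "f absolutely_integrable_on {a..b}" and "a \<le> b"
    and g: "\<And>x. x \<in> {a..b} \<Longrightarrow> (g has_real_derivative g' x) (at x within {a..b})"
    and g': "continuous_on {a..b} g'"
  shows "integral {a..b} (\<lambda>t. g t * f t) =
    g b * integral {a..b} f - integral {a..b} (\<lambda>t. g' t * integral {a..t} f)"
proof -
  define \<Phi> where "\<Phi> x = integral {a..x} f" for x
  define \<Psi> where "\<Psi> x = integral {a..x} (\<lambda>t. \<bar>f t\<bar>)" for x
  have fi: "f integrable_on {a..b}" and fai: "(\<lambda>t. \<bar>f t\<bar>) integrable_on {a..b}"
    using f by (auto simp: absolutely_integrable_on_def)
  have cg: "continuous_on {a..b} g" using g by (rule DERIV_continuous_on)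
  have c\<Phi>: "continuous_on {a..b} \<Phi>" and c\<Psi>: "continuous_on {a..b} \<Psi>"
    unfolding \<Phi>_def \<Psi>_def using fi fai by (auto intro: indefinite_integral_continuous_1)
  have gf: "(\<lambda>t. g t * f t) integrable_on {a..b}"
    by (rule set_lebesgue_integral_eq_integral(1)[OF absolutely_integrable_continuous_mult[OF cg f]])
  have g\<Phi>: "(\<lambda>t. g' t * \<Phi> t) integrable_on {a..b}"
    by (intro integrable_continuous_real continuous_intros g' c\<Phi>)
  obtain L where L: "\<And>x. x \<in> {a..b} \<Longrightarrow> \<bar>g' x\<bar> \<le> L" and "L \<ge> 0"
  proof -
    have "bounded (g' ` {a..b})" using g' by (simp add: compact_continuous_image compact_imp_bounded)
    then obtain B where "\<forall>x\<in>{a..b}. \<bar>g' x\<bar> \<le> B" by (auto simp: bounded_iff)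
    then show ?thesis using that[of "max B 0"] by force
  qed
  txt \<open>\<open>\<Phi>\<close> is differentiable only almost everywhere, but the defect \<open>H\<close> of the identity
    has derivative 0 everywhere, because its increments are \<open>O((y - x) (\<Psi> y - \<Psi> x))\<close>.\<close>
  define H where "H x = integral {a..x} (\<lambda>t. g t * f t) - g x * \<Phi> x + integral {a..x} (\<lambda>t. g' t * \<Phi> t)" for x
  have split: "integral {a..y} k - integral {a..x} k = integral {x..y} k"
    if "k integrable_on {a..b}" "a \<le> x" "x \<le> y" "y \<le> b" for k :: "real \<Rightarrow> real" and x y
  proof -
    have "integral {a..x} k + integral {x..y} k = integral {a..y} k"
      by (rule Henstock_Kurzweil_Integration.integral_combine)
        (use that in \<open>auto intro: integrable_subinterval_real[OF that(1)]\<close>)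
    then show ?thesis by simp
  qed
  have sub: "k integrable_on {x..y}" if "k integrable_on {a..b}" "a \<le> x" "x \<le> y" "y \<le> b" for k :: "real \<Rightarrow> real" and x y
    by (rule integrable_subinterval_real[OF that(1)]) (use that in auto)
  have H: "\<bar>H y - H x\<bar> \<le> 2 * L * (y - x) * (\<Psi> y - \<Psi> x)" if xy: "a \<le> x" "x \<le> y" "y \<le> b" for x y
  proof -
    note S = split[OF _ xy] and B = sub[OF _ xy]
    have gd: "g y - g x = integral {x..y} g'"
    proof -
      have "(g' has_integral (g y - g x)) {x..y}"
        using xy by (intro fundamental_theorem_of_calculus)
          (auto simp flip: has_real_derivative_iff_has_vector_derivative intro!: DERIV_subset[OF g])
      then show ?thesis by (simp add: integral_unique)
    qed
    \<comment> \<open>Centering g at the right end y and \<open>\<Phi>\<close> at the left end x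
      makes the boundary terms cancel in the increment of \<open>H\<close>, and each integrand
      contains a small difference: at most L * (y - x) for g, at most
      \<open>\<Psi> y - \<Psi> x\<close> for \<open>\<Phi>\<close>.\<close>
    have I1: "integral {x..y} (\<lambda>t. (g t - g y) * f t) = integral {x..y} (\<lambda>t. g t * f t) - g y * (\<Phi> y - \<Phi> x)"
      unfolding \<Phi>_def S[OF fi] left_diff_distrib
      by (subst Henstock_Kurzweil_Integration.integral_diff) (simp_all add: B[OF gf] B[OF fi] integrable_on_mult_right)
    have I2: "integral {x..y} (\<lambda>t. g' t * (\<Phi> t - \<Phi> x)) = integral {x..y} (\<lambda>t. g' t * \<Phi> t) - (g y - g x) * \<Phi> x"
      unfolding gd right_diff_distrib
      by (subst Henstock_Kurzweil_Integration.integral_diff)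
        (simp_all add: B[OF g\<Phi>] B[OF integrable_continuous_real[OF g']] integrable_on_mult_left)
    have eq: "H y - H x = integral {x..y} (\<lambda>t. (g t - g y) * f t) + integral {x..y} (\<lambda>t. g' t * (\<Phi> t - \<Phi> x))"
      unfolding I1 I2 S[OF gf, symmetric] S[OF g\<Phi>, symmetric] H_def by (simp add: algebra_simps)
    have gl: "\<bar>g t - g y\<bar> \<le> L * (y - x)" if t: "t \<in> {x..y}" for t
    proof -
      have "norm (g t - g y) \<le> L * norm (t - y)"
        by (rule field_differentiable_bound[of "{a..b}" g g']) (use g L xy t in auto)
      also have "\<dots> \<le> L * (y - x)" using t \<open>L \<ge> 0\<close> by (intro mult_left_mono) auto
      finally show ?thesis by simp
    qed
    have "norm (integral {x..y} (\<lambda>t. (g t - g y) * f t)) \<le> integral {x..y} (\<lambda>t. L * (y - x) * \<bar>f t\<bar>)"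
    proof (rule integral_norm_bound_integral)
      show "(\<lambda>t. (g t - g y) * f t) integrable_on {x..y}"
        unfolding left_diff_distrib by (intro integrable_diff integrable_on_mult_right B[OF gf] B[OF fi])
      show "(\<lambda>t. L * (y - x) * \<bar>f t\<bar>) integrable_on {x..y}"
        by (intro integrable_on_mult_right B[OF fai])
      show "norm ((g t - g y) * f t) \<le> L * (y - x) * \<bar>f t\<bar>" if "t \<in> {x..y}" for t
        using gl[OF that] by (auto simp: abs_mult intro: mult_right_mono)
    qed
    also have "\<dots> = L * (y - x) * (\<Psi> y - \<Psi> x)" unfolding \<Psi>_def S[OF fai] by simp
    finally have 1: "\<bar>integral {x..y} (\<lambda>t. (g t - g y) * f t)\<bar> \<le> L * (y - x) * (\<Psi> y - \<Psi> x)" by simp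
    have "norm (integral {x..y} (\<lambda>t. g' t * (\<Phi> t - \<Phi> x))) \<le> integral {x..y} (\<lambda>t. L * (\<Psi> y - \<Psi> x))"
    proof (rule integral_norm_bound_integral)
      show "(\<lambda>t. g' t * (\<Phi> t - \<Phi> x)) integrable_on {x..y}"
        using xy by (intro integrable_continuous_real continuous_intros continuous_on_subset[OF g'] continuous_on_subset[OF c\<Phi>]) auto
      fix t assume t: "t \<in> {x..y}"
      have "\<bar>\<Phi> t - \<Phi> x\<bar> \<le> \<Psi> y - \<Psi> x"
      proof -
        have "norm (integral {x..t} f) \<le> integral {x..t} (\<lambda>t. \<bar>f t\<bar>)"
          by (rule integral_norm_bound_integral) (use sub[OF fi, of x t] sub[OF fai, of x t] t xy in auto)
        also have "\<dots> \<le> integral {x..y} (\<lambda>t. \<bar>f t\<bar>)"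
          using t xy by (intro integral_subset_le sub[OF fai]) auto
        finally show ?thesis unfolding \<Phi>_def \<Psi>_def S[OF fai] using split[OF fi, of x t] t xy by simp
      qed
      then show "norm (g' t * (\<Phi> t - \<Phi> x)) \<le> L * (\<Psi> y - \<Psi> x)"
        unfolding real_norm_def abs_mult using L[of t] t xy \<open>L \<ge> 0\<close> by (intro mult_mono) auto
    qed auto
    also have "\<dots> = L * (y - x) * (\<Psi> y - \<Psi> x)" using xy by simp
    finally have 2: "\<bar>integral {x..y} (\<lambda>t. g' t * (\<Phi> t - \<Phi> x))\<bar> \<le> L * (y - x) * (\<Psi> y - \<Psi> x)" by simp
    show ?thesis unfolding eq using 1 2 by linarith
  qed
  have H2: "\<bar>H y - H x\<bar> \<le> 2 * L * \<bar>y - x\<bar> * \<bar>\<Psi> y - \<Psi> x\<bar>" if "x \<in> {a..b}" "y \<in> {a..b}" for x y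
  proof (cases "x \<le> y")
    case True
    then have "\<bar>H y - H x\<bar> \<le> 2 * L * \<bar>y - x\<bar> * (\<Psi> y - \<Psi> x)" using H[of x y] that by auto
    also have "\<dots> \<le> 2 * L * \<bar>y - x\<bar> * \<bar>\<Psi> y - \<Psi> x\<bar>" using \<open>L \<ge> 0\<close> by (intro mult_left_mono) auto
    finally show ?thesis .
  next
    case False
    then have "\<bar>H y - H x\<bar> \<le> 2 * L * \<bar>y - x\<bar> * (\<Psi> x - \<Psi> y)" using H[of y x] that by auto
    also have "\<dots> \<le> 2 * L * \<bar>y - x\<bar> * \<bar>\<Psi> y - \<Psi> x\<bar>" using \<open>L \<ge> 0\<close> by (intro mult_left_mono) auto
    finally show ?thesis .
  qed
  have dH: "(H has_real_derivative 0) (at x within {a..b})" if x: "x \<in> {a..b}" for x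
    unfolding has_field_derivative_iff
  proof (rule Lim_null_comparison)
    have "(\<Psi> \<longlongrightarrow> \<Psi> x) (at x within {a..b})" using c\<Psi> x by (simp add: continuous_on)
    then have "((\<lambda>y. 2 * L * \<bar>\<Psi> y - \<Psi> x\<bar>) \<longlongrightarrow> 2 * L * \<bar>\<Psi> x - \<Psi> x\<bar>) (at x within {a..b})"
      by (intro tendsto_intros)
    then show "((\<lambda>y. 2 * L * \<bar>\<Psi> y - \<Psi> x\<bar>) \<longlongrightarrow> 0) (at x within {a..b})" by simp
    show "\<forall>\<^sub>F y in at x within {a..b}. norm ((H y - H x) / (y - x)) \<le> 2 * L * \<bar>\<Psi> y - \<Psi> x\<bar>"
      unfolding eventually_at_filter
      by (rule always_eventually) (use H2[OF x] in \<open>auto simp: abs_divide divide_le_eq algebra_simps\<close>)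
  qed
  have "H b = H a"
    using has_field_derivative_zero_constant[of "{a..b}" H] dH \<open>a \<le> b\<close>
    by (metis atLeastAtMost_iff convex_real_interval(5) order_refl)
  then show ?thesis by (simp add: H_def \<Phi>_def)
qed

text \<open>This is I'' + s^2 I = F in integrated form, the form that makes sense at every point for
  integrable F. Integration by parts replaces F by its continuous primitive; the addition theorem
  then takes x out of the kernel, so that \<open>I\<close> is a combination of continuously
  differentiable functions \<open>P\<close> and \<open>Q\<close>.\<close>

lemma duhamel_has_derivative:
  fixes F :: "real \<Rightarrow> real"
  assumes F: "F absolutely_integrable_on {a..b}" and s: "s \<noteq> 0" and x: "x \<in> {a..b}"
  defines "I \<equiv> \<lambda>x. integral {a..x} (\<lambda>\<xi>. sin (s * (x - \<xi>)) / s * F \<xi>)"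
  shows "(I has_real_derivative integral {a..x} (\<lambda>\<xi>. F \<xi> - s\<^sup>2 * I \<xi>)) (at x within {a..b})"
    and "continuous_on {a..b} I"
proof -
  define \<Phi> where "\<Phi> x = integral {a..x} F" for x
  have c\<Phi>: "continuous_on {a..b} \<Phi>"
    unfolding \<Phi>_def using F by (auto intro: indefinite_integral_continuous_1 simp: set_lebesgue_integral_eq_integral(1))
  define P where "P x = integral {a..x} (\<lambda>t. cos (s * t) * \<Phi> t)" for x
  define Q where "Q x = integral {a..x} (\<lambda>t. sin (s * t) * \<Phi> t)" for x
  have P: "(P has_real_derivative cos (s * x) * \<Phi> x) (at x within {a..b})"
   and Q: "(Q has_real_derivative sin (s * x) * \<Phi> x) (at x within {a..b})" if "x \<in> {a..b}" for x
    unfolding P_def Q_def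
    by (rule integral_has_real_derivative[OF _ that], intro continuous_intros c\<Phi>)+
  have I: "I x = cos (s * x) * P x + sin (s * x) * Q x" if x: "x \<in> {a..b}" for x
  proof -
    have ax: "{a..x} \<subseteq> {a..b}" using x by auto
    note c = continuous_on_subset[OF c\<Phi> ax]
    have "I x = sin (s * (x - x)) / s * integral {a..x} F - integral {a..x} (\<lambda>t. - cos (s * (x - t)) * integral {a..t} F)"
      unfolding I_def
      by (rule integral_mult_by_parts)
        (use x s in \<open>auto intro!: absolutely_integrable_on_subinterval[OF F] derivative_eq_intros continuous_intros\<close>)
    also have "\<dots> = integral {a..x} (\<lambda>t. cos (s * (x - t)) * \<Phi> t)"
      by (simp add: \<Phi>_def)
    also have "\<dots> = integral {a..x} (\<lambda>t. cos (s * x) * (cos (s * t) * \<Phi> t) + sin (s * x) * (sin (s * t) * \<Phi> t))"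
      by (simp add: right_diff_distrib cos_diff algebra_simps)
    also have "\<dots> = cos (s * x) * P x + sin (s * x) * Q x"
      unfolding P_def Q_def
      by (subst Henstock_Kurzweil_Integration.integral_add)
        (auto intro!: integrable_continuous_real continuous_intros c)
    finally show ?thesis .
  qed
  \<comment> \<open>The part of the derivative of \<open>I\<close> that is itself differentiable
    everywhere; the rest is the primitive \<open>\<Phi>\<close> of F.\<close>
  define W where "W x = - s * sin (s * x) * P x + s * cos (s * x) * Q x" for x
  have dW: "(W has_real_derivative - (s\<^sup>2 * I x)) (at x within {a..b})" if "x \<in> {a..b}" for x
  proof -
    have "(W has_real_derivative - (s\<^sup>2 * (cos (s * x) * P x + sin (s * x) * Q x))) (at x within {a..b})"
      unfolding W_def
      by (rule derivative_eq_intros P[OF that] Q[OF that] refl)+ (simp add: power2_eq_square algebra_simps)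
    then show ?thesis by (simp add: I[OF that])
  qed
  have dI: "(I has_real_derivative \<Phi> x + W x) (at x within {a..b})" if "x \<in> {a..b}" for x
  proof -
    have "((\<lambda>x. cos (s * x) * P x + sin (s * x) * Q x) has_real_derivative \<Phi> x + W x) (at x within {a..b})"
    proof -
      have "cos (s * x) * (cos (s * x) * \<Phi> x) + sin (s * x) * (sin (s * x) * \<Phi> x) = \<Phi> x"
        using sin_cos_squared_add[of "s * x"] by (simp add: power2_eq_square flip: distrib_right mult.assoc)
      then show ?thesis
        unfolding W_def
        by - (rule derivative_eq_intros P[OF that] Q[OF that] refl | simp add: algebra_simps)+
    qed
    then show ?thesis
      by (rule has_field_derivative_transform_within[where d = 1]) (use that in \<open>auto simp: I\<close>)
  qed
  show cI: "continuous_on {a..b} I" using dI by (rule DERIV_continuous_on)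
  have "integral {a..x} (\<lambda>\<xi>. F \<xi> - s\<^sup>2 * I \<xi>) = \<Phi> x + W x"
  proof -
    have "((\<lambda>\<xi>. - (s\<^sup>2 * I \<xi>)) has_integral W x - W a) {a..x}"
      using x by (intro fundamental_theorem_of_calculus)
        (auto simp flip: has_real_derivative_iff_has_vector_derivative intro!: DERIV_subset[OF dW])
    then have "((\<lambda>\<xi>. - (s\<^sup>2 * I \<xi>)) has_integral W x) {a..x}" by (simp add: W_def P_def Q_def)
    moreover have "(F has_integral \<Phi> x) {a..x}"
      unfolding \<Phi>_def using x
      by (intro integrable_integral set_lebesgue_integral_eq_integral(1) absolutely_integrable_on_subinterval[OF F]) auto
    ultimately have "((\<lambda>\<xi>. F \<xi> + - (s\<^sup>2 * I \<xi>)) has_integral \<Phi> x + W x) {a..x}"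
      by (intro has_integral_add)
    then show ?thesis by (simp add: integral_unique)
  qed
  then show "(I has_real_derivative integral {a..x} (\<lambda>\<xi>. F \<xi> - s\<^sup>2 * I \<xi>)) (at x within {a..b})"
    using dI[OF x] by simp
qed

section \<open>The unperturbed eigenvalue\<close>

text \<open>Monotonicity of f t / sin t settles the open interval only; f may also vanish at the
  ends, namely if \<beta> = 0 or the sine of pi * m * \<alpha> is 0. There f' equals (-1)^m * pi *
  m. At the left end this sign excludes a second root, and at the right end it supplies a nearby
  interior point with the sign that the intermediate value theorem requires.\<close>

lemma characteristic_root_unique:
  fixes \<alpha> \<beta> :: real
  assumes \<alpha>: "0 < \<alpha>" "\<alpha> < 1" and \<beta>: "\<beta> \<ge> 0" and n: "n > 0"
  shows "\<exists>!t. pi * real n \<le> t \<and> t < pi * (real n + 1) \<and>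
     t * sin t = - \<beta> * sin (t * \<alpha>) * sin (t * (1 - \<alpha>))"
proof -
  define f where "f t = t * sin t + \<beta> * sin (t * \<alpha>) * sin (t * (1 - \<alpha>))" for t
  define f' where "f' t = sin t + t * cos t +
     \<beta> * (\<alpha> * cos (t * \<alpha>) * sin (t * (1 - \<alpha>)) + (1 - \<alpha>) * sin (t * \<alpha>) * cos (t * (1 - \<alpha>)))" for t
  define \<sigma> :: real where "\<sigma> = (-1) ^ n"
  have \<sigma>2: "\<sigma> * \<sigma> = 1" unfolding \<sigma>_def by (simp flip: power_add mult_2)
  have \<sigma>sq: "\<sigma> * (\<sigma> * x) = x" for x using \<sigma>2 by (simp flip: mult.assoc)
  have \<sigma>Suc: "(-1) ^ Suc n = - \<sigma>" by (simp add: \<sigma>_def)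
  have df: "(f has_real_derivative f' t) (at t)" for t
    unfolding f_def f'_def by (rule derivative_eq_intros refl | simp add: algebra_simps)+
  have f_npi: "f (pi * real m) = - ((-1) ^ m * (\<beta> * (sin (pi * real m * \<alpha>))\<^sup>2))" for m
  proof -
    have "sin (pi * real m * (1 - \<alpha>)) = sin (pi * real m - pi * real m * \<alpha>)"
      by (simp add: algebra_simps)
    also have "\<dots> = - ((-1) ^ m * sin (pi * real m * \<alpha>))"
      unfolding sin_diff by simp
    finally show ?thesis unfolding f_def by (simp add: power2_eq_square algebra_simps)
  qed
  have f'_npi: "f' (pi * real m) = (-1) ^ m * (pi * real m)" if "f (pi * real m) = 0" for m
  proof -
    have "\<beta> = 0 \<or> sin (pi * real m * \<alpha>) = 0" using that f_npi[of m] by simp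
    moreover have "sin (pi * real m * (1 - \<alpha>)) = - ((-1) ^ m * sin (pi * real m * \<alpha>))"
      using sin_diff[of "pi * real m" "pi * real m * \<alpha>"] by (simp add: algebra_simps)
    ultimately show ?thesis unfolding f'_def by auto
  qed
  have sin_pos: "\<sigma> * sin t > 0" if "pi * real n < t" "t < pi * (real n + 1)" for t
  proof -
    have "sin (pi * real n + (t - pi * real n)) = \<sigma> * sin (t - pi * real n)"
      unfolding sin_add \<sigma>_def by simp
    then have "\<sigma> * sin t = sin (t - pi * real n)" by (simp add: \<sigma>sq)
    also have "\<dots> > 0" using that by (intro sin_gt_zero) (auto simp: algebra_simps)
    finally show ?thesis .
  qed
  txt \<open>Inside the interval, \<open>g t = t + \<beta> / (cot (t \<alpha>) + cot (t (1 - \<alpha>)))\<close>, which is increasing.\<close>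
  define g where "g t = f t / sin t" for t
  have g_mono: "g t1 < g t2" if t: "pi * real n < t1" "t1 < t2" "t2 < pi * (real n + 1)" for t1 t2
  proof (rule DERIV_pos_imp_increasing[OF t(2)])
    fix t assume "t1 \<le> t" "t \<le> t2"
    then have s0: "sin t \<noteq> 0" using sin_pos[of t] t by auto
    let ?S = "sin (t * \<alpha>)" and ?C = "cos (t * \<alpha>)" and ?S' = "sin (t * (1 - \<alpha>))" and ?C' = "cos (t * (1 - \<alpha>))"
    have split: "sin t = ?S * ?C' + ?C * ?S'" "cos t = ?C * ?C' - ?S * ?S'"
      using sin_add[of "t * \<alpha>" "t * (1 - \<alpha>)"] cos_add[of "t * \<alpha>" "t * (1 - \<alpha>)"]
      by (simp_all add: algebra_simps)
    have "f' t * sin t - f t * cos t =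
      (sin t)\<^sup>2 + \<beta> * ((\<alpha> * ?C * ?S' + (1 - \<alpha>) * ?S * ?C') * sin t - ?S * ?S' * cos t)"
      unfolding f'_def f_def by (simp add: algebra_simps power2_eq_square)
    also have "(\<alpha> * ?C * ?S' + (1 - \<alpha>) * ?S * ?C') * sin t - ?S * ?S' * cos t =
      \<alpha> * ?S'\<^sup>2 * (?S\<^sup>2 + ?C\<^sup>2) + (1 - \<alpha>) * ?S\<^sup>2 * (?S'\<^sup>2 + ?C'\<^sup>2)"
    proof -
      have "(\<alpha> * c * s' + (1 - \<alpha>) * s * c') * (s * c' + c * s') - s * s' * (c * c' - s * s') =
        \<alpha> * s'\<^sup>2 * (s\<^sup>2 + c\<^sup>2) + (1 - \<alpha>) * s\<^sup>2 * (s'\<^sup>2 + c'\<^sup>2)" for s c s' c' :: real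
        by (simp add: algebra_simps power2_eq_square)
      then show ?thesis unfolding split .
    qed
    also have "\<dots> = \<alpha> * ?S'\<^sup>2 + (1 - \<alpha>) * ?S\<^sup>2" by simp
    finally have num: "f' t * sin t - f t * cos t = (sin t)\<^sup>2 + \<beta> * (\<alpha> * ?S'\<^sup>2 + (1 - \<alpha>) * ?S\<^sup>2)" .
    have D: "(g has_real_derivative (f' t * sin t - f t * cos t) / (sin t * sin t)) (at t)"
      unfolding g_def by (rule DERIV_divide df DERIV_sin s0)+
    have "f' t * sin t - f t * cos t > 0"
      unfolding num using s0 \<alpha> \<beta> by (intro add_pos_nonneg) auto
    moreover have "sin t * sin t > 0" using s0 by (simp flip: power2_eq_square)
    ultimately show "\<exists>y. (g has_real_derivative y) (at t) \<and> y > 0"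
      using D divide_pos_pos by blast
  qed
  have uniq: False if t: "pi * real n \<le> t1" "t1 < t2" "t2 < pi * (real n + 1)" "f t1 = 0" "f t2 = 0" for t1 t2
  proof (cases "t1 = pi * real n")
    case False
    then show False using g_mono[of t1 t2] t by (simp add: g_def)
  next
    case True
    have "((\<lambda>t. \<sigma> * f t) has_real_derivative \<sigma> * f' t1) (at t1)" by (rule DERIV_cmult df)+
    moreover have "\<sigma> * f' t1 > 0"
      using f'_npi[of n] t(4) n unfolding True \<sigma>_def[symmetric] by (simp add: \<sigma>sq)
    ultimately obtain d where d: "d > 0" "\<And>h. h > 0 \<Longrightarrow> h < d \<Longrightarrow> \<sigma> * f t1 < \<sigma> * f (t1 + h)"
      using DERIV_pos_inc_right by blast
    obtain h where "h > 0" "h < d" "h < t2 - t1"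
      using field_lbound_gt_zero[of d "t2 - t1"] d(1) t(2) by auto
    then have h: "h > 0" "h < d" "t1 + h < t2" by simp_all
    have "\<sigma> * f (t1 + h) > 0" using d(2)[of h] h t by simp
    moreover have "\<sigma> * sin (t1 + h) > 0" using h t True by (intro sin_pos) auto
    ultimately have "(\<sigma> * f (t1 + h)) / (\<sigma> * sin (t1 + h)) > 0" by (rule divide_pos_pos)
    then have "g (t1 + h) > 0" using \<sigma>2 by (cases "\<sigma> = 0") (simp_all add: g_def)
    moreover have "g (t1 + h) < g t2" using h t True by (intro g_mono) auto
    ultimately show False using t by (simp add: g_def)
  qed
  have ex: "\<exists>t. pi * real n \<le> t \<and> t < pi * (real n + 1) \<and> f t = 0"
  proof (cases "f (pi * real n) = 0")
    case True
    then show ?thesis by (intro exI[of _ "pi * real n"]) simp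
  next
    case False
    have le: "\<sigma> * f (pi * real n) \<le> 0" unfolding f_npi \<sigma>_def[symmetric] using \<beta> by (simp add: \<sigma>sq)
    have ge: "\<sigma> * f (pi * real (Suc n)) \<ge> 0" unfolding f_npi \<sigma>Suc using \<beta> by (simp add: \<sigma>sq)
    \<comment> \<open>The right end does not count as a root. A strictly positive sign at
      \<open>T\<close> keeps the root found below \<open>T\<close>, hence below pi * (n +
      1).\<close>
    obtain T where T: "pi * real n < T" "T \<le> pi * (real n + 1)" "\<sigma> * f T > 0"
    proof (cases "f (pi * real (Suc n)) = 0")
      case True
      have "((\<lambda>t. \<sigma> * f t) has_real_derivative \<sigma> * f' (pi * real (Suc n))) (at (pi * real (Suc n)))"
        by (rule DERIV_cmult df)+
      moreover have "\<sigma> * f' (pi * real (Suc n)) < 0"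
        unfolding f'_npi[OF True] \<sigma>Suc by (simp add: \<sigma>sq add_pos_nonneg)
      ultimately obtain d where d: "d > 0"
        "\<And>h. h > 0 \<Longrightarrow> h < d \<Longrightarrow> \<sigma> * f (pi * real (Suc n)) < \<sigma> * f (pi * real (Suc n) - h)"
        using DERIV_neg_dec_left by blast
      obtain h where h: "h > 0" "h < d" "h < pi"
        using field_lbound_gt_zero[of d pi] d(1) by auto
      have "pi * real (Suc n) = pi * real n + pi" by (simp add: algebra_simps)
      then show ?thesis
        using d(2)[OF h(1,2)] h True by (intro that[of "pi * real (Suc n) - h"]) (simp_all add: add.commute)
    next
      case False
      moreover have "\<sigma> \<noteq> 0" using \<sigma>2 by auto
      ultimately show ?thesis using ge
        by (intro that[of "pi * real (Suc n)"]) (simp_all add: less_le add.commute)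
    qed
    have "\<exists>t\<ge>pi * real n. t \<le> T \<and> \<sigma> * f t = 0"
      using T le unfolding f_def by (intro IVT' continuous_intros) simp_all
    then obtain t where t: "pi * real n \<le> t" "t \<le> T" "\<sigma> * f t = 0" by blast
    moreover have "t \<noteq> T" using t T by auto
    ultimately show ?thesis using T \<sigma>2 by (intro exI[of _ t]) auto
  qed
  have eq: "t * sin t = - \<beta> * sin (t * \<alpha>) * sin (t * (1 - \<alpha>)) \<longleftrightarrow> f t = 0" for t
    unfolding f_def by auto
  obtain t where t: "pi * real n \<le> t" "t < pi * (real n + 1)" "f t = 0" using ex by blast
  show ?thesis unfolding eq
  proof (rule ex1I[of _ t])
    fix t' assume t': "pi * real n \<le> t' \<and> t' < pi * (real n + 1) \<and> f t' = 0"
    show "t' = t" using uniq[of t t'] uniq[of t' t] t t' by (cases t t' rule: linorder_cases) auto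
  qed (use t in simp)
qed

text \<open>Evaluates the definite description in \<open>fd_lam0\<close>: existence and uniqueness
  of t carry over to lam = t^2. The bound by pi, where n > 0 enters, guarantees two quarter periods
  in [0,1].\<close>

lemma fd_s_props:
  fixes \<alpha> \<beta> :: real
  assumes "0 < \<alpha>" "\<alpha> < 1" "\<beta> \<ge> 0" "n > 0"
  shows "fd_s \<alpha> \<beta> n \<ge> pi"
    and "fd_s \<alpha> \<beta> n * sin (fd_s \<alpha> \<beta> n)
       = - \<beta> * sin (fd_s \<alpha> \<beta> n * \<alpha>) * sin (fd_s \<alpha> \<beta> n * (1 - \<alpha>))"
    and "fd_lam0 \<alpha> \<beta> n = (fd_s \<alpha> \<beta> n)\<^sup>2"
proof -
  define P where "P t \<longleftrightarrow> pi * real n \<le> t \<and> t < pi * (real n + 1) \<and>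
     t * sin t = - \<beta> * sin (t * \<alpha>) * sin (t * (1 - \<alpha>))" for t
  define L where "L lam \<longleftrightarrow> pi\<^sup>2 * (real n)\<^sup>2 \<le> lam \<and> lam < pi\<^sup>2 * (real n + 1)\<^sup>2 \<and>
     sqrt lam * sin (sqrt lam) = - \<beta> * sin (sqrt lam * \<alpha>) * sin (sqrt lam * (1 - \<alpha>))" for lam
  have LP: "L lam \<longleftrightarrow> lam \<ge> 0 \<and> P (sqrt lam)" for lam
  proof -
    have "lam \<ge> 0" if "pi\<^sup>2 * (real n)\<^sup>2 \<le> lam" using that by (meson order_trans zero_le_mult_iff zero_le_power2)
    moreover have "pi\<^sup>2 * (real n)\<^sup>2 \<le> lam \<longleftrightarrow> pi * real n \<le> sqrt lam" if "lam \<ge> 0"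
    proof -
      have "pi\<^sup>2 * (real n)\<^sup>2 = (pi * real n)\<^sup>2" by (simp add: power_mult_distrib)
      moreover have "(pi * real n)\<^sup>2 \<le> lam \<longleftrightarrow> sqrt ((pi * real n)\<^sup>2) \<le> sqrt lam"
        by (rule real_sqrt_le_iff[symmetric])
      ultimately show ?thesis by (simp add: abs_mult)
    qed
    moreover have "lam < pi\<^sup>2 * (real n + 1)\<^sup>2 \<longleftrightarrow> sqrt lam < pi * (real n + 1)" if "lam \<ge> 0"
    proof -
      have "pi\<^sup>2 * (real n + 1)\<^sup>2 = (pi * (real n + 1))\<^sup>2" by (simp add: power_mult_distrib)
      moreover have "lam < (pi * (real n + 1))\<^sup>2 \<longleftrightarrow> sqrt lam < sqrt ((pi * (real n + 1))\<^sup>2)"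
        by (rule real_sqrt_less_iff[symmetric])
      ultimately show ?thesis by (simp add: abs_mult)
    qed
    ultimately show ?thesis unfolding L_def P_def by blast
  qed
  obtain t where t: "P t" "\<And>t'. P t' \<Longrightarrow> t' = t"
    using characteristic_root_unique[OF assms] unfolding P_def[symmetric] by blast
  have t_pi: "t \<ge> pi"
  proof -
    have "pi * 1 \<le> pi * real n" using assms(4) by (intro mult_left_mono) auto
    then show ?thesis using t(1) unfolding P_def by linarith
  qed
  then have t0: "t \<ge> 0" using pi_gt_zero by linarith
  have "(THE lam. L lam) = t\<^sup>2"
  proof (rule the_equality)
    show "L (t\<^sup>2)" unfolding LP using t(1) t0 by simp
    fix lam assume "L lam"
    then have "lam \<ge> 0" "sqrt lam = t" using t(2) unfolding LP by blast+
    then show "lam = t\<^sup>2" by auto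
  qed
  then have lam0: "fd_lam0 \<alpha> \<beta> n = t\<^sup>2" unfolding fd_lam0_def L_def by simp
  then have s: "fd_s \<alpha> \<beta> n = t" unfolding fd_s_def using t0 by simp
  show "fd_s \<alpha> \<beta> n \<ge> pi" using s t_pi by simp
  show "fd_lam0 \<alpha> \<beta> n = (fd_s \<alpha> \<beta> n)\<^sup>2" using s lam0 by simp
  show "fd_s \<alpha> \<beta> n * sin (fd_s \<alpha> \<beta> n)
       = - \<beta> * sin (fd_s \<alpha> \<beta> n * \<alpha>) * sin (fd_s \<alpha> \<beta> n * (1 - \<alpha>))"
    unfolding s using t(1) unfolding P_def by blast
qed

section \<open>The majorant sequence\<close>

lemma fd_alpha_1: "fd_alpha 1 = 1 / 4"
  by (simp add: fd_alpha_def numeral_eq_Suc)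

lemma fd_alpha_Suc:
  assumes "j \<ge> 1"
  shows "fd_alpha (Suc j) = fd_alpha j * (2 * real j - 1) / (2 * real j + 2)"
proof -
  obtain i where i: "j = Suc i" using assms by (cases j) auto
  \<comment> \<open>For i = 0 the argument 2 * j - 3 is truncated to 0 and the other one is 1, so
    the recursion of \<open>dfact\<close> does not link them; both values are 1, as the convention
    for (-1)!! demands.\<close>
  have "dfact (2 * Suc j - 3) = (2 * i + 1) * dfact (2 * j - 3)"
  proof (cases i)
    case (Suc k)
    then have "2 * Suc j - 3 = Suc (Suc (2 * j - 3))" "Suc (Suc (2 * j - 3)) = 2 * i + 1" using i by auto
    then show ?thesis by (metis dfact.simps(3))
  qed (simp add: i numeral_eq_Suc)
  moreover have "dfact (2 * Suc j) = (2 * j + 2) * dfact (2 * j)" by simp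
  moreover have "dfact m > 0" for m by (induction m rule: dfact.induct) auto
  then have "real (dfact (2 * j)) \<noteq> 0" by (metis less_numeral_extra(3) of_nat_eq_0_iff)
  ultimately show ?thesis unfolding fd_alpha_def i by (simp add: field_simps)
qed

lemma fd_alpha_nonneg: "fd_alpha j \<ge> 0"
  by (simp add: fd_alpha_def)

lemma fd_alpha_antimono:
  assumes "1 \<le> i" "i \<le> j"
  shows "fd_alpha j \<le> fd_alpha i"
  using assms(2)
proof (induction rule: dec_induct)
  case (step m)
  have "fd_alpha (Suc m) \<le> fd_alpha m"
    unfolding fd_alpha_Suc[OF order_trans[OF assms(1) step(1)]]
    using fd_alpha_nonneg[of m] by (simp add: divide_le_eq mult_left_mono)
  then show ?case using step by simp
qed simp

text \<open>The weights decrease from index 1 on, so the weight of the first omitted term serves for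
  the whole tail and leaves a geometric series. Used for the eigenvalue corrections and, at each
  point, for the eigenfunction corrections.\<close>

lemma fd_alpha_geometric_tail:
  fixes x :: "nat \<Rightarrow> real"
  assumes r: "0 \<le> r" "r < 1" and K: "K \<ge> 0"
    and x: "\<And>k. \<bar>x (Suc k)\<bar> \<le> K * (fd_alpha (Suc k) * r ^ k)"
  shows "summable (\<lambda>k. \<bar>x k\<bar>)"
    and "\<bar>suminf x - (\<Sum>j\<le>m. x j)\<bar> \<le> K * (fd_alpha (Suc m) * r ^ m) / (1 - r)"
proof -
  have le: "\<bar>x (i + Suc m)\<bar> \<le> K * fd_alpha (Suc m) * r ^ m * r ^ i" for i m
  proof -
    have "\<bar>x (i + Suc m)\<bar> \<le> K * (fd_alpha (Suc (i + m)) * r ^ (i + m))" using x[of "i + m"] by simp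
    also have "\<dots> \<le> K * (fd_alpha (Suc m) * r ^ (i + m))"
      using K r by (intro mult_left_mono mult_right_mono fd_alpha_antimono) auto
    finally show ?thesis by (simp add: power_add mult_ac)
  qed
  have sums: "(\<lambda>i. K * fd_alpha (Suc m) * r ^ m * r ^ i) sums (K * fd_alpha (Suc m) * r ^ m * (1 / (1 - r)))" for m
    using r by (intro sums_mult geometric_sums) auto
  have "summable (\<lambda>i. \<bar>x (i + Suc 0)\<bar>)"
    by (rule summable_comparison_test'[OF sums_summable[OF sums[of 0]]]) (use le[of _ 0] in simp)
  then show abs: "summable (\<lambda>k. \<bar>x k\<bar>)" by (subst (asm) summable_iff_shift)
  then have x: "summable x" by (rule summable_rabs_cancel)
  have "suminf x - (\<Sum>j\<le>m. x j) = (\<Sum>i. x (i + Suc m))"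
    using suminf_minus_initial_segment[OF x, of "Suc m"] by (simp add: lessThan_Suc_atMost)
  also have "\<bar>\<dots>\<bar> \<le> (\<Sum>i. \<bar>x (i + Suc m)\<bar>)"
    by (rule summable_rabs) (use abs in \<open>subst summable_iff_shift\<close>)
  also have "\<dots> \<le> (\<Sum>i. K * fd_alpha (Suc m) * r ^ m * r ^ i)"
    by (rule suminf_le[OF le _ sums_summable[OF sums]]) (use abs in \<open>subst summable_iff_shift\<close>)
  also have "\<dots> = K * (fd_alpha (Suc m) * r ^ m) / (1 - r)"
    using sums_unique[OF sums[of m]] by (simp add: mult.assoc)
  finally show "\<bar>suminf x - (\<Sum>j\<le>m. x j)\<bar> \<le> K * (fd_alpha (Suc m) * r ^ m) / (1 - r)" .
qed

section \<open>Square roots as formal power series\<close>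

context includes no vec_syntax and fps_syntax
begin

text \<open>The power series of sqrt (1 - c X). The double factorials in \<open>fd_alpha\<close> are
  the binomial coefficients of exponent 1/2, up to sign and the factor 2.\<close>

definition sqrt_fps :: "real \<Rightarrow> real fps" where
  "sqrt_fps c = Abs_fps (\<lambda>j. if j = 0 then 1 else - 2 * fd_alpha j * c ^ j)"

lemma sqrt_fps_nth_binomial: "sqrt_fps c $ j = (1 / 2 gchoose j) * (- c) ^ j"
proof (induction j)
  case (Suc j)
  show ?case
  proof (cases "j = 0")
    case True
    then show ?thesis using fd_alpha_1 by (simp add: sqrt_fps_def)
  next
    case False
    have rec: "(1 / 2 gchoose Suc j) = (1 / 2 gchoose j) * (1 / 2 - real j) / (real j + 1)"
      by (simp add: gbinomial_prod_rev field_simps)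
    have "sqrt_fps c $ j = - 2 * fd_alpha j * c ^ j"
      and "sqrt_fps c $ Suc j = - 2 * (fd_alpha j * (2 * real j - 1) / (2 * real j + 2)) * c ^ Suc j"
      using False fd_alpha_Suc[of j] by (simp_all add: sqrt_fps_def)
    then have "sqrt_fps c $ Suc j = sqrt_fps c $ j * (2 * real j - 1) / (2 * real j + 2) * c"
      by (simp only: power_Suc divide_inverse ac_simps)
    also have "\<dots> = (1 / 2 gchoose Suc j) * (- c) ^ Suc j"
      unfolding Suc rec by (simp add: field_simps)
    finally show ?thesis .
  qed
qed (simp add: sqrt_fps_def)

text \<open>Every term of the m-th convolution coefficient contains (-c)^m, so the claim reduces to
  the square of the binomial series of exponent 1/2, and exponents add.\<close>

lemma sqrt_fps_square: "sqrt_fps c * sqrt_fps c = 1 - fps_const c * fps_X"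
proof (rule fps_ext)
  fix m
  have "(sqrt_fps c * sqrt_fps c) $ m = (\<Sum>i=0..m. (1/2 gchoose i) * (1/2 gchoose (m - i)) * (- c) ^ m)"
    unfolding fps_mult_nth sqrt_fps_nth_binomial
  proof (rule sum.cong)
    fix i assume "i \<in> {0..m}"
    then have "(- c) ^ m = (- c) ^ i * (- c) ^ (m - i)" by (simp flip: power_add)
    then show "(1 / 2 gchoose i) * (- c) ^ i * ((1 / 2 gchoose (m - i)) * (- c) ^ (m - i)) =
      (1/2 gchoose i) * (1/2 gchoose (m - i)) * (- c) ^ m" by simp
  qed simp
  also have "\<dots> = (fps_binomial (1/2) * fps_binomial (1/2)) $ m * (- c) ^ m"
    by (simp add: fps_mult_nth sum_distrib_right)
  also have "fps_binomial (1/2) * fps_binomial (1/2) = 1 + (fps_X :: real fps)"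
    by (simp add: fps_binomial_1 flip: fps_binomial_add_mult)
  finally show "(sqrt_fps c * sqrt_fps c) $ m = (1 - fps_const c * fps_X) $ m"
    by (cases m) auto
qed

text \<open>The generating function \<open>G\<close> of the sequence \<open>g\<close> without \<open>g 0\<close> solves \<open>G = G\<^sup>2 + X G + v X\<close>, hence
  \<open>2 G = 1 - X - sqrt ((1 - X / \<rho>) (1 - \<rho> X))\<close>.\<close>

lemma fd_majorant:
  fixes v :: real
  assumes v: "v > 0"
  defines "\<rho> \<equiv> 1 + 2 * v - 2 * sqrt (v * (1 + v))"
  obtains g :: "nat \<Rightarrow> real" where "g 0 = v" "0 < \<rho>"
    "\<And>k. g (Suc k) = (\<Sum>p=1..k. g (Suc k - p) * g p) + g k"
    "\<And>j. j \<ge> 1 \<Longrightarrow> g j \<le> fd_alpha j / \<rho> ^ j"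
proof -
  define w where "w = sqrt (v * (1 + v))"
  have w2: "w * w = v * (1 + v)" and w0: "w \<ge> 0" using v unfolding w_def by auto
  \<comment> \<open>\<open>\<rho>\<close> and its reciprocal are the zeros of (1 - X)^2 - 4 v X, the
    discriminant of the quadratic equation for G: their product is 1 and their sum is 2 + 4
    v.\<close>
  have prod: "(1 + 2 * v - 2 * w) * (1 + 2 * v + 2 * w) = 1"
    using w2 by (simp add: algebra_simps)
  have \<rho>w: "\<rho> = 1 + 2 * v - 2 * w" by (simp add: \<rho>_def w_def)
  have big: "1 + 2 * v + 2 * w \<ge> 1" using v w0 by simp
  have \<rho>inv: "1 / \<rho> = 1 + 2 * v + 2 * w"
  proof -
    have "\<rho> * (1 + 2 * v + 2 * w) = 1" using prod by (simp add: \<rho>w)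
    moreover from this have "\<rho> \<noteq> 0" by auto
    ultimately show ?thesis by (metis eq_divide_imp mult.commute)
  qed
  have \<rho>pos: "\<rho> > 0" using \<rho>inv big by (metis zero_less_divide_1_iff less_le_trans zero_less_one)
  have \<rho>le: "\<rho> \<le> 1" using \<rho>inv big \<rho>pos by (metis divide_le_eq_1_pos le_divide_eq_1_pos)
  have \<rho>sum: "\<rho> + 1 / \<rho> = 2 + 4 * v" using \<rho>inv \<rho>w by linarith
  \<comment> \<open>The square root of the discriminant, one factor for each of its zeros.\<close>
  define S where "S = sqrt_fps (1 / \<rho>) * sqrt_fps \<rho>"
  have S2: "S * S = 1 - fps_const (2 + 4 * v) * fps_X + fps_X * fps_X"
  proof -
    have "S * S = (1 - fps_const (1 / \<rho>) * fps_X) * (1 - fps_const \<rho> * fps_X)"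
      unfolding S_def sqrt_fps_square[symmetric] by (simp only: ac_simps)
    also have "\<dots> = 1 - (fps_const \<rho> + fps_const (1 / \<rho>)) * fps_X + fps_const (1 / \<rho>) * fps_const \<rho> * (fps_X * fps_X)"
      by (simp add: algebra_simps del: fps_const_add fps_const_mult)
    also have "fps_const \<rho> + fps_const (1 / \<rho>) = fps_const (2 + 4 * v)" by (simp only: fps_const_add \<rho>sum)
    also have "fps_const (1 / \<rho>) * fps_const \<rho> = 1" using \<rho>pos by simp
    finally show ?thesis by simp
  qed
  define G where "G = fps_const (1 / 2) * (1 - fps_X - S)"
  have c2: "2 * G = 1 - fps_X - S"
  proof -
    have "2 * G = (2 * fps_const (1 / 2)) * (1 - fps_X - S)" unfolding G_def by (rule mult.assoc[symmetric])
    also have "2 * fps_const (1 / 2) = (1 :: real fps)" by (simp add: numeral_fps_const)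
    finally show ?thesis by simp
  qed
  have "4 * (G * G + fps_X * G - G + fps_const v * fps_X) =
      (2 * G) * (2 * G) + 2 * (fps_X - 1) * (2 * G) + 4 * fps_const v * fps_X"
    by (simp add: algebra_simps)
  also have "\<dots> = S * S - 1 + (2 + 4 * fps_const v) * fps_X - fps_X * fps_X"
    unfolding c2 by (simp add: algebra_simps)
  also have "2 + 4 * fps_const v = fps_const (2 + 4 * v)" by (simp add: numeral_fps_const)
  also have "S * S - 1 + fps_const (2 + 4 * v) * fps_X - fps_X * fps_X = 0" unfolding S2 by simp
  finally have Geq: "G * G + fps_X * G - G + fps_const v * fps_X = 0"
    by (simp only: mult_eq_0_iff) simp
  have G0: "G $ 0 = 0" unfolding G_def S_def by (simp add: sqrt_fps_def)
  have conv: "(G * G) $ Suc k = (\<Sum>p=1..k. G $ (Suc k - p) * G $ p)" for k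
  proof -
    have "(G * G) $ Suc k = (\<Sum>p=0..Suc k. G $ (Suc k - p) * G $ p)"
      unfolding fps_mult_nth by (simp add: mult.commute)
    also have "\<dots> = (\<Sum>p=1..k. G $ (Suc k - p) * G $ p)"
      by (rule sum.mono_neutral_right) (auto simp: G0 not_le le_Suc_eq)
    finally show ?thesis .
  qed
  have rec: "G $ Suc k = (\<Sum>p=1..k. G $ (Suc k - p) * G $ p) + G $ k + (if k = 0 then v else 0)" for k
  proof -
    have "(G * G + fps_X * G - G + fps_const v * fps_X) $ Suc k = 0" unfolding Geq by simp
    then show ?thesis unfolding fps_add_nth fps_sub_nth conv by (simp add: fps_X_nth split: if_splits)
  qed
  have bound: "G $ j \<le> fd_alpha j / \<rho> ^ j" if "j \<ge> 1" for j
  proof (cases "j = 1")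
    case True
    \<comment> \<open>Degree 1 is separate because the comparison below relies on a vanishing
      coefficient of 1 - X. Here the claim is 4 v \<le> 1 / \<rho>, which follows from \<rho> + 1 /
      \<rho> = 2 + 4 v and \<rho> \<le> 1.\<close>
    have "G $ 1 = v" using rec[of 0] G0 by simp
    also have "v \<le> 1 / 4 / \<rho>" using \<rho>sum \<rho>le by simp
    finally show ?thesis unfolding True fd_alpha_1 by simp
  next
    case False
    have ends: "(\<Sum>i=0..j. h i) = h 0 + h j + (\<Sum>i=1..<j. h i)" for h :: "nat \<Rightarrow> real"
    proof -
      have "(\<Sum>i=0..j. h i) = h 0 + (\<Sum>i=Suc 0..j. h i)" by (simp add: sum.atLeast_Suc_atMost)
      also have "(\<Sum>i=Suc 0..j. h i) = (\<Sum>i=Suc 0..<j. h i) + h j"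
        using that by (metis One_nat_def sum.last_plus add.commute)
      finally show ?thesis by simp
    qed
    \<comment> \<open>Comparison with c = 1: the coefficients of 1 - X vanish from degree 2 on,
      which evaluates the inner convolution sum as \<open>4 * fd_alpha j\<close>. In
      \<open>S\<close> each inner term has an extra weight of at least \<open>\<rho> ^ j\<close>, so
      the inner sum outweighs the end term with \<open>\<rho> ^ j\<close>, and only
      \<open>fd_alpha j / \<rho> ^ j\<close> remains in the bound for G.\<close>
    have "(sqrt_fps 1 * sqrt_fps 1) $ j = 0"
      unfolding sqrt_fps_square using False that by (simp add: fps_X_nth)
    then have one: "(\<Sum>i=1..<j. 4 * fd_alpha i * fd_alpha (j - i)) = 4 * fd_alpha j"
      unfolding fps_mult_nth ends using that by (simp add: sqrt_fps_def mult.assoc)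
    have "S $ j = - 2 * fd_alpha j * \<rho> ^ j - 2 * fd_alpha j / \<rho> ^ j
       + (\<Sum>i=1..<j. 4 * fd_alpha i * fd_alpha (j - i) * ((1 / \<rho>) ^ i * \<rho> ^ (j - i)))"
      unfolding S_def fps_mult_nth ends using that by (simp add: sqrt_fps_def mult_ac power_one_over divide_inverse power_inverse)
    moreover have "(\<Sum>i=1..<j. 4 * fd_alpha i * fd_alpha (j - i) * ((1 / \<rho>) ^ i * \<rho> ^ (j - i))) \<ge>
      (\<Sum>i=1..<j. 4 * fd_alpha i * fd_alpha (j - i) * \<rho> ^ j)"
    proof (rule sum_mono, rule mult_left_mono)
      fix i assume i: "i \<in> {1..<j}"
      have "\<rho> ^ j \<le> 1 * \<rho> ^ (j - i)" using \<rho>pos \<rho>le by (simp add: power_decreasing)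
      also have "\<dots> \<le> (1 / \<rho>) ^ i * \<rho> ^ (j - i)"
        using \<rho>pos \<rho>le by (intro mult_right_mono one_le_power) auto
      finally show "\<rho> ^ j \<le> (1 / \<rho>) ^ i * \<rho> ^ (j - i)" .
    qed (simp add: fd_alpha_nonneg)
    moreover have "(\<Sum>i=1..<j. 4 * fd_alpha i * fd_alpha (j - i) * \<rho> ^ j) = 4 * fd_alpha j * \<rho> ^ j"
      unfolding one[symmetric] by (simp add: sum_distrib_right)
    moreover have "fd_alpha j * \<rho> ^ j \<ge> 0" using \<rho>pos fd_alpha_nonneg by simp
    moreover have "G $ j = - (S $ j / 2)" unfolding G_def using False that by (simp add: fps_X_nth)
    ultimately show ?thesis by linarith
  qed
  \<comment> \<open>The coefficient of G at 0 is 0, whereas the sequence starts with v. This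
    replacement absorbs the inhomogeneous term v X into the summand \<open>g k\<close> for k = 0;
    the convolution involves only indices from 1 on.\<close>
  show ?thesis
  proof (rule that[of "\<lambda>j. if j = 0 then v else G $ j"])
    fix k
    show "(if Suc k = 0 then v else G $ Suc k) = (\<Sum>p=1..k. (if Suc k - p = 0 then v else G $ (Suc k - p)) *
       (if p = 0 then v else G $ p)) + (if k = 0 then v else G $ k)"
    proof -
      have "(\<Sum>p=1..k. (if Suc k - p = 0 then v else G $ (Suc k - p)) * (if p = 0 then v else G $ p)) =
        (\<Sum>p=1..k. G $ (Suc k - p) * G $ p)" by (rule sum.cong) auto
      then show ?thesis using rec[of k] G0 by (cases "k = 0") simp_all
    qed
    show "(if j = 0 then v else G $ j) \<le> fd_alpha j / \<rho> ^ j" if "j \<ge> 1" for j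
      using bound[OF that] that by (cases j) (simp_all only: nat.simps if_False not_one_le_zero)
  qed (simp_all only: \<rho>pos if_True simp_thms)
qed

end

section \<open>The corrections\<close>

lemma abs_le_norm_inf:
  assumes "continuous_on {0..1} v" "x \<in> {0..1}"
  shows "\<bar>v x\<bar> \<le> norm_inf v"
proof -
  have "compact ((\<lambda>x. \<bar>v x\<bar>) ` {0..1})"
    by (intro compact_continuous_image continuous_intros assms(1)) simp
  then have "bdd_above ((\<lambda>x. \<bar>v x\<bar>) ` {0..1})"
    by (intro bounded_imp_bdd_above compact_imp_bounded)
  then show ?thesis unfolding norm_inf_def by (rule cSUP_upper[OF assms(2)])
qed

lemma norm_inf_le:
  assumes "\<And>x. x \<in> {0..1} \<Longrightarrow> \<bar>v x\<bar> \<le> C"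
  shows "norm_inf v \<le> C"
  unfolding norm_inf_def by (rule cSUP_least) (use assms in auto)

lemma norm_inf_nonneg:
  assumes "continuous_on {0..1} v"
  shows "norm_inf v \<ge> 0"
  by (rule order_trans[OF abs_ge_zero abs_le_norm_inf[OF assms, of 0]]) simp

declare fd_lam.simps(2) [simp del] fd_F.simps(2) [simp del] fd_c.simps(2) [simp del] fd_u.simps(2) [simp del]

locale fd_problem =
  fixes \<alpha> \<beta> :: real and q :: "real \<Rightarrow> real" and n :: nat
  assumes \<alpha>0: "0 < \<alpha>" and \<alpha>1: "\<alpha> < 1" and \<beta>0: "\<beta> \<ge> 0"
    and q: "q absolutely_integrable_on {0..1}" and n0: "n > 0"
begin

abbreviation "s \<equiv> fd_s \<alpha> \<beta> n"
abbreviation "lam0 \<equiv> fd_lam0 \<alpha> \<beta> n"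
abbreviation "c0 \<equiv> fd_c0 \<alpha> \<beta> n"
abbreviation "u0 \<equiv> fd_u0 \<alpha> \<beta> n"
abbreviation "M \<equiv> fd_M \<alpha> \<beta> n"
abbreviation "ct \<equiv> fd_ctilde \<alpha> \<beta> n"
abbreviation "b \<equiv> fd_b \<alpha> \<beta> n"
abbreviation "v0 \<equiv> fd_v0 \<alpha> \<beta> n"
abbreviation "lam \<equiv> fd_lam \<alpha> \<beta> q n"
abbreviation "F \<equiv> fd_F \<alpha> \<beta> q n"
abbreviation "u \<equiv> fd_u \<alpha> \<beta> q n"

section \<open>Matching conditions of the unperturbed eigenfunction\<close>

lemma s_ge_pi: "s \<ge> pi" and lam0_eq: "lam0 = s\<^sup>2"
  and characteristic: "s * sin s = - \<beta> * sin (s * \<alpha>) * sin (s * (1 - \<alpha>))"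
  using fd_s_props[OF \<alpha>0 \<alpha>1 \<beta>0 n0] by auto

lemma s_pos: "s > 0" using s_ge_pi pi_gt_zero by linarith

lemma s_split: "s = s * \<alpha> + s * (1 - \<alpha>)" by (simp add: algebra_simps)

text \<open>The matching conditions of \<open>u0\<close> at \<alpha>: continuity, and the jump of
  the derivative. The second is the characteristic equation with sin s expanded. If sin (s * (1 -
  \<alpha>)) = 0, the characteristic equation forces sin s = 0, and the second branch of
  \<open>fd_c0\<close> takes over.\<close>

lemma amplitude_sin: "s * c0 * sin (s * (1 - \<alpha>)) = sin (s * \<alpha>)"
  and amplitude_cos: "s * c0 * cos (s * (1 - \<alpha>)) = - (cos (s * \<alpha>) + \<beta> / s * sin (s * \<alpha>))"
proof -
  let ?A = "s * \<alpha>" and ?B = "s * (1 - \<alpha>)"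
  have add: "sin s = sin ?A * cos ?B + cos ?A * sin ?B"
    using sin_add[of ?A ?B] s_split by simp
  have A: "?A = s - ?B" by (simp add: algebra_simps)
  show "s * c0 * sin ?B = sin ?A"
  proof (cases "sin ?B = 0")
    case True
    then have "sin s = 0" using characteristic s_pos by simp
    then have "sin ?A = 0" using True unfolding A sin_diff by simp
    then show ?thesis using True by simp
  qed (use s_pos in \<open>simp add: fd_c0_def\<close>)
  show "s * c0 * cos ?B = - (cos ?A + \<beta> / s * sin ?A)"
  proof (cases "sin ?B = 0")
    case True
    then have "sin s = 0" using characteristic s_pos by simp
    then have "sin ?A = 0" "cos ?A = cos s * cos ?B" using True unfolding A sin_diff cos_diff by simp_all
    then show ?thesis using True s_pos by (simp add: fd_c0_def)
  next
    case False
    have "sin ?A * cos ?B = sin s - cos ?A * sin ?B" using add by simp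
    also have "sin s = - (\<beta> / s * sin ?A) * sin ?B"
      using characteristic s_pos by (simp add: field_simps)
    finally have "sin ?A * cos ?B = - (cos ?A + \<beta> / s * sin ?A) * sin ?B" by (simp add: algebra_simps)
    moreover have "s * c0 * cos ?B = sin ?A * cos ?B / sin ?B" using False s_pos by (simp add: fd_c0_def)
    ultimately show ?thesis using False by simp
  qed
qed

text \<open>The expression for \<open>ct\<close> read from the end 1, where the ratio of the
  amplitudes is inverted: the matching conditions are solved for the sine and cosine of s *
  \<alpha>, whose squares add up to 1.\<close>

lemma amplitude_normalized:
  "(s * c0)\<^sup>2 * ((sin (s * (1 - \<alpha>)))\<^sup>2 + (cos (s * (1 - \<alpha>)) + \<beta> / s * sin (s * (1 - \<alpha>)))\<^sup>2) = 1"
proof -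
  have "cos (s * \<alpha>) = - (s * c0) * (cos (s * (1 - \<alpha>)) + \<beta> / s * sin (s * (1 - \<alpha>)))"
  proof -
    have "x = - K * (C + D * S)" if "K * C = - (x + D * (K * S))" for x K C D S :: real
      using that by (simp add: algebra_simps)
    then show ?thesis using amplitude_cos unfolding amplitude_sin[symmetric] .
  qed
  then have "(s * c0 * sin (s * (1 - \<alpha>)))\<^sup>2
      + (- (s * c0) * (cos (s * (1 - \<alpha>)) + \<beta> / s * sin (s * (1 - \<alpha>))))\<^sup>2 = 1"
    using sin_cos_squared_add[of "s * \<alpha>"] unfolding amplitude_sin by simp
  moreover have "K\<^sup>2 * (x\<^sup>2 + y\<^sup>2) = 1" if "(K * x)\<^sup>2 + (- K * y)\<^sup>2 = 1" for K x y :: real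
    using that by (simp add: power_mult_distrib distrib_left)
  ultimately show ?thesis by blast
qed

lemma ct_eq: "ct = (s * c0)\<^sup>2"
proof -
  have "ct = (s * c0)\<^sup>2 * ((sin (s * (1 - \<alpha>)))\<^sup>2 + (cos (s * (1 - \<alpha>)))\<^sup>2)"
    unfolding fd_ctilde_def distrib_left power_mult_distrib[symmetric]
    by (simp only: amplitude_sin amplitude_cos power2_minus)
  then show ?thesis by simp
qed

lemma sqrt_ct: "sqrt ct = \<bar>s * c0\<bar>" unfolding ct_eq by (rule real_sqrt_abs)

lemma c0_nonzero: "c0 \<noteq> 0" using amplitude_normalized by auto

lemma sqrt_ct_pos: "sqrt ct > 0" unfolding sqrt_ct using c0_nonzero s_pos by simp

text \<open>\<open>T f\<close> solves \<open>y'' + s\<^sup>2 y = f\<close> with \<open>y 0 = y' 0 = 0\<close> and the jump condition at \<open>\<alpha>\<close>: it equals \<open>z f\<close> up to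
  \<open>\<alpha>\<close>, and the jump \<open>\<beta> y \<alpha>\<close> of the derivative adds a multiple of \<open>sin (s (x - \<alpha>))\<close> afterwards.\<close>

definition J :: "real \<Rightarrow> real" where
  "J x = \<beta> / s * sin (s * max 0 (x - \<alpha>))"

definition z :: "(real \<Rightarrow> real) \<Rightarrow> real \<Rightarrow> real" where
  "z f x = integral {0..x} (\<lambda>\<xi>. sin (s * (x - \<xi>)) / s * f \<xi>)"

definition T :: "(real \<Rightarrow> real) \<Rightarrow> real \<Rightarrow> real" where
  "T f x = z f x + J x * z f \<alpha>"

lemma continuous_J: "continuous_on S J"
  unfolding J_def by (intro continuous_intros)

lemma abs_J_le: "\<bar>J x\<bar> \<le> \<beta> / s"
proof -
  have "\<bar>J x\<bar> = \<beta> / s * \<bar>sin (s * max 0 (x - \<alpha>))\<bar>" using \<beta>0 s_pos by (simp add: J_def abs_mult)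
  also have "\<dots> \<le> \<beta> / s * 1" using \<beta>0 s_pos by (intro mult_left_mono) auto
  finally show ?thesis by simp
qed

lemma u0_right: "x \<ge> \<alpha> \<Longrightarrow> u0 x = c0 * sin (s * (1 - x))"
  using amplitude_sin s_pos by (cases "x = \<alpha>") (auto simp: fd_u0_def field_simps)

text \<open>The same shape as \<open>T f\<close>, with sin (s x) / s in place of \<open>z f\<close>.
  This common shape lets \<open>u0\<close> and all corrections be summed together.\<close>

lemma u0_eq: "u0 x = sin (s * x) / s + J x * (sin (s * \<alpha>) / s)"
proof (cases "x \<le> \<alpha>")
  case True
  then show ?thesis by (simp add: fd_u0_def J_def)
next
  case False
  let ?B = "s * (1 - \<alpha>)" and ?t = "s * (x - \<alpha>)"
  have "s * u0 x = s * c0 * sin (?B - ?t)" using False by (simp add: u0_right algebra_simps)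
  also have "\<dots> = (s * c0 * sin ?B) * cos ?t - (s * c0 * cos ?B) * sin ?t"
  proof -
    have "K * (x * y - w * v) = K * x * y - K * w * v" for K x y w v :: real by (simp add: algebra_simps)
    then show ?thesis unfolding sin_diff[of ?B ?t] .
  qed
  also have "\<dots> = sin (s * \<alpha> + ?t) + \<beta> / s * sin ?t * sin (s * \<alpha>)"
  proof -
    have "x * c - - (y + D * x) * w = x * c + y * w + D * w * x" for x y c w D :: real
      by (simp add: algebra_simps)
    then show ?thesis unfolding amplitude_sin amplitude_cos sin_add .
  qed
  also have "s * \<alpha> + ?t = s * x" by (simp add: algebra_simps)
  finally show ?thesis using False s_pos by (simp add: J_def field_simps)
qed

lemma continuous_u0: "continuous_on S u0"
  unfolding u0_eq by (intro continuous_intros continuous_J) (use s_pos in auto)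

lemma continuous_T:
  assumes "f absolutely_integrable_on {0..1}"
  shows "continuous_on {0..1} (T f)"
proof -
  have "continuous_on {0..1} (z f)"
    unfolding z_def[abs_def] using duhamel_has_derivative(2)[OF assms, of s 0] s_pos by simp
  then show ?thesis unfolding T_def[abs_def] by (intro continuous_intros continuous_J)
qed

lemma abs_z_le:
  assumes f: "f absolutely_integrable_on {0..1}" and x: "x \<in> {0..1}"
  shows "\<bar>z f x\<bar> \<le> 1 / s * norm_L1 f"
proof -
  have fx: "f absolutely_integrable_on {0..x}" by (rule absolutely_integrable_on_subinterval[OF f]) (use x in auto)
  have "norm (z f x) \<le> integral {0..x} (\<lambda>\<xi>. 1 / s * \<bar>f \<xi>\<bar>)"
    unfolding z_def
  proof (rule integral_norm_bound_integral)
    show "(\<lambda>\<xi>. sin (s * (x - \<xi>)) / s * f \<xi>) integrable_on {0..x}"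
      using s_pos by (intro set_lebesgue_integral_eq_integral(1) absolutely_integrable_continuous_mult[OF _ fx] continuous_intros) auto
    show "(\<lambda>\<xi>. 1 / s * \<bar>f \<xi>\<bar>) integrable_on {0..x}"
      using fx by (intro integrable_on_mult_right) (simp add: absolutely_integrable_on_def)
    show "norm (sin (s * (x - \<xi>)) / s * f \<xi>) \<le> 1 / s * \<bar>f \<xi>\<bar>" for \<xi>
      unfolding real_norm_def abs_mult using s_pos by (intro mult_right_mono) (auto simp: divide_right_mono)
  qed
  also have "\<dots> = 1 / s * integral {0..x} (\<lambda>\<xi>. \<bar>f \<xi>\<bar>)" by simp
  also have "\<dots> \<le> 1 / s * norm_L1 f"
    unfolding norm_L1_def using s_pos x f fx
    by (intro mult_left_mono integral_subset_le) (auto simp: absolutely_integrable_on_def)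
  finally show ?thesis by simp
qed

lemma norm_L1_nonneg: "norm_L1 f \<ge> 0"
  unfolding norm_L1_def by (cases "(\<lambda>x. \<bar>f x\<bar>) integrable_on {0..1}")
   (auto intro: Henstock_Kurzweil_Integration.integral_nonneg simp: not_integrable_integral)

lemma abs_T_le:
  assumes f: "f absolutely_integrable_on {0..1}" and x: "x \<in> {0..1}"
  shows "\<bar>T f x\<bar> \<le> (1 + \<beta> / s) / s * norm_L1 f"
proof -
  have "\<bar>T f x\<bar> \<le> \<bar>z f x\<bar> + \<bar>J x\<bar> * \<bar>z f \<alpha>\<bar>" unfolding T_def by (metis abs_mult abs_triangle_ineq)
  also have "\<dots> \<le> 1 / s * norm_L1 f + \<beta> / s * (1 / s * norm_L1 f)"
    using \<beta>0 s_pos \<alpha>0 \<alpha>1 by (intro add_mono mult_mono abs_z_le[OF f] x abs_J_le) auto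
  finally show ?thesis by (simp add: algebra_simps add_divide_distrib)
qed

text \<open>Since \<open>s \<ge> pi\<close>, one of the two pieces contains a quarter period. A piece that does not
  contain one has the smaller amplitude, by \<open>ct \<ge> 1\<close> resp. the mirror image
  \<open>amplitude_normalized\<close>.\<close>

lemma norm_inf_u0: "norm_inf u0 = max 1 (sqrt ct) / s"
proof (rule antisym)
  show "norm_inf u0 \<le> max 1 (sqrt ct) / s"
  proof (rule norm_inf_le)
    fix x :: real
    show "\<bar>u0 x\<bar> \<le> max 1 (sqrt ct) / s"
    proof (cases "x \<le> \<alpha>")
      case True
      have "\<bar>sin (s * x)\<bar> \<le> max 1 (sqrt ct)" using abs_sin_le_one[of "s * x"] by linarith
      then show ?thesis using True s_pos by (simp add: fd_u0_def abs_divide divide_right_mono)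
    next
      case False
      have "s * \<bar>u0 x\<bar> = sqrt ct * \<bar>sin (s * (1 - x))\<bar>"
        unfolding sqrt_ct using False s_pos by (simp add: u0_right abs_mult)
      also have "\<dots> \<le> sqrt ct * 1" using sqrt_ct_pos by (intro mult_left_mono) auto
      finally have "s * \<bar>u0 x\<bar> \<le> max 1 (sqrt ct)" by simp
      then show ?thesis using s_pos by (simp add: field_simps)
    qed
  qed
next
  let ?A = "s * \<alpha>" and ?B = "s * (1 - \<alpha>)"
  have pos: "?A > 0" "?B > 0" using s_pos \<alpha>0 \<alpha>1 by auto
  have right: "sqrt ct / s \<le> norm_inf u0" if "?B \<ge> pi / 2"
  proof -
    let ?x = "1 - pi / 2 / s"
    have "pi / 2 / s \<le> 1 - \<alpha>" using that s_pos by (simp add: pos_divide_le_eq mult.commute)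
    moreover have "pi / 2 / s \<ge> 0" using s_pos by simp
    ultimately have "?x \<ge> \<alpha>" "?x \<in> {0..1}" using \<alpha>0 by auto
    moreover have "\<bar>u0 ?x\<bar> = sqrt ct / s"
      using u0_right[OF \<open>?x \<ge> \<alpha>\<close>] s_pos by (simp add: sqrt_ct abs_mult)
    ultimately show ?thesis using abs_le_norm_inf[OF continuous_u0] by metis
  qed
  have left: "1 / s \<le> norm_inf u0" if "?A \<ge> pi / 2"
  proof -
    let ?x = "pi / 2 / s"
    have "?x \<le> \<alpha>" using that s_pos by (simp add: pos_divide_le_eq mult.commute)
    moreover have "?x \<ge> 0" using s_pos by simp
    moreover have "\<bar>u0 ?x\<bar> = 1 / s" using \<open>?x \<le> \<alpha>\<close> s_pos by (simp add: fd_u0_def)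
    ultimately show ?thesis using abs_le_norm_inf[OF continuous_u0, of ?x] \<alpha>1 by simp
  qed
  have ge1: "(sin t)\<^sup>2 + (cos t + \<beta> / s * sin t)\<^sup>2 \<ge> 1" if "0 < t" "t < pi / 2" for t
  proof -
    have st: "sin t > 0" "cos t > 0" using that by (auto intro!: sin_gt_zero cos_gt_zero)
    have "(cos t)\<^sup>2 \<le> (cos t + \<beta> / s * sin t)\<^sup>2"
      using st \<beta>0 s_pos by (intro power_mono) auto
    then show ?thesis using sin_cos_squared_add[of t] by linarith
  qed
  show "max 1 (sqrt ct) / s \<le> norm_inf u0"
  proof (cases "?A < pi / 2")
    case True
    then have "ct \<ge> 1" using ge1[OF pos(1)] by (simp add: fd_ctilde_def)
    then have "sqrt ct \<ge> 1" by simp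
    moreover have "?B \<ge> pi / 2" using True s_ge_pi s_split by linarith
    ultimately show ?thesis using right by (simp add: max_def)
  next
    case A: False
    show ?thesis
    proof (cases "?B < pi / 2")
      case True
      have "ct * 1 \<le> ct * ((sin ?B)\<^sup>2 + (cos ?B + \<beta> / s * sin ?B)\<^sup>2)"
        using ge1[OF pos(2) True] by (intro mult_left_mono) (auto simp: ct_eq)
      then have "ct \<le> 1" using amplitude_normalized unfolding ct_eq by simp
      then have "sqrt ct \<le> 1" by simp
      then show ?thesis using left A by (simp add: max_def)
    next
      case False
      then show ?thesis using right left A by (simp add: max_def)
    qed
  qed
qed

section \<open>Comparison of the constants\<close>

lemma integral_u0_sq_pos: "integral {0..1} (\<lambda>\<xi>. (u0 \<xi>)\<^sup>2) > 0"
proof -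
  have cont: "continuous_on {0..1} (\<lambda>\<xi>. (u0 \<xi>)\<^sup>2)" by (intro continuous_intros continuous_u0)
  have "integral {0..1} (\<lambda>\<xi>. (u0 \<xi>)\<^sup>2) \<ge> 0"
    by (intro Henstock_Kurzweil_Integration.integral_nonneg integrable_continuous_real cont) auto
  moreover have "integral {0..1} (\<lambda>\<xi>. (u0 \<xi>)\<^sup>2) \<noteq> 0"
  proof
    assume "integral {0..1} (\<lambda>\<xi>. (u0 \<xi>)\<^sup>2) = 0"
    then have "\<forall>x\<in>{0..1}. (u0 x)\<^sup>2 = 0"
      by (subst (asm) integral_eq_0_iff[OF cont]) auto
    then have "norm_inf u0 \<le> 0" by (intro norm_inf_le) auto
    then show False using s_pos unfolding norm_inf_u0 by (simp add: divide_le_0_iff max_def split: if_splits)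
  qed
  ultimately show ?thesis by linarith
qed

lemma M_pos: "M > 0"
  unfolding fd_M_def lam0_eq using integral_u0_sq_pos s_pos by simp

lemma norm_inf_u0_pos: "norm_inf u0 > 0"
  unfolding norm_inf_u0 using s_pos by (simp add: less_max_iff_disj)

lemma b_ge: "b \<ge> 1" "b \<ge> s / M" "b \<ge> s * sqrt ct / M"
  unfolding fd_b_def by (auto intro: Max_ge)

lemma v0_pos: "v0 > 0"
  unfolding fd_v0_def using b_ge(1) norm_inf_u0_pos by simp

text \<open>The origin of two entries of \<open>fd_b\<close>: the factor of the eigenvalue recursion
  is exactly their maximum.\<close>

lemma lam0_M_norm_u0_le: "lam0 / M * norm_inf u0 \<le> b"
proof -
  have "lam0 / M * norm_inf u0 = max (s / M) (s * sqrt ct / M)"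
    unfolding norm_inf_u0 lam0_eq using s_pos M_pos by (simp add: max_def power2_eq_square field_simps)
  then show ?thesis using b_ge by simp
qed

text \<open>Divided by M, each entry of the maximum is an entry of \<open>fd_b\<close> times one of
  the amplitudes 1 / s and sqrt ct / s. This turns 1 + \<open>v0\<close> into the denominator of the
  eigenvalue estimate.\<close>

lemma v0_ge: "v0 \<ge> Max {1, ct, sqrt ct * M / s} / M"
proof -
  have sq: "sqrt ct * sqrt ct = ct"
  proof -
    have "ct \<ge> 0" unfolding ct_eq by simp
    then show ?thesis by simp
  qed
  have 1: "1 / s \<le> norm_inf u0" "sqrt ct / s \<le> norm_inf u0"
    unfolding norm_inf_u0 using s_pos by (auto intro: divide_right_mono)
  have "s / M * (1 / s) \<le> b * norm_inf u0" "s * sqrt ct / M * (sqrt ct / s) \<le> b * norm_inf u0"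
    "1 * (sqrt ct / s) \<le> b * norm_inf u0"
    using b_ge 1 s_pos M_pos sqrt_ct_pos by (intro mult_mono; simp)+
  then have "1 / M \<le> v0" "ct / M \<le> v0" "sqrt ct / s \<le> v0"
    unfolding fd_v0_def using s_pos sq by (simp_all add: mult.assoc)
  then have "1 \<le> v0 * M" "ct \<le> v0 * M" "sqrt ct * M / s \<le> v0 * M"
    using M_pos s_pos by (simp_all add: field_simps)
  then show ?thesis using M_pos by (simp add: divide_le_eq)
qed

text \<open>Replaces the two-branch formula by \<open>T f\<close>, which is continuous and bounded
  by the L1 norm of f without any division by sin (s * (1 - \<alpha>)). Orthogonality makes the two
  equations for the constant compatible; they determine it because sine and cosine do not vanish
  together.\<close>

lemma fd_T_formula:
  assumes f: "f absolutely_integrable_on {0..1}" and orth: "integral {0..1} (\<lambda>x. f x * u0 x) = 0"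
  defines "c1 \<equiv> (THE c.
     c * sin (s * (1 - \<alpha>)) = integral {0..1} (\<lambda>\<xi>. sin (s * (\<alpha> - \<xi>)) / s * f \<xi>) \<and>
     c * cos (s * (1 - \<alpha>)) = - integral {0..1} (\<lambda>\<xi>. cos (s * (\<alpha> - \<xi>)) / s * f \<xi>)
         - \<beta> * integral {0..\<alpha>} (\<lambda>\<xi>. sin (s * (\<alpha> - \<xi>)) / lam0 * f \<xi>))"
  assumes x: "x \<in> {0..1}"
  shows "(if x \<le> \<alpha> then integral {0..x} (\<lambda>\<xi>. sin (s * (x - \<xi>)) / s * f \<xi>)
      else c1 * sin (s * (1 - x)) - integral {x..1} (\<lambda>\<xi>. sin (s * (x - \<xi>)) / s * f \<xi>)) = T f x"
proof -
  let ?B = "s * (1 - \<alpha>)"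
  define P where "P = integral {0..1} (\<lambda>\<xi>. sin (s * (\<alpha> - \<xi>)) / s * f \<xi>)"
  define N where "N = integral {0..1} (\<lambda>\<xi>. cos (s * (\<alpha> - \<xi>)) / s * f \<xi>)"
  define Z where "Z = z f \<alpha>"
  have Z': "integral {0..\<alpha>} (\<lambda>\<xi>. sin (s * (\<alpha> - \<xi>)) / lam0 * f \<xi>) = Z / s"
    unfolding Z_def z_def lam0_eq power2_eq_square by (simp flip: integral_divide add: field_simps)
  have int: "(\<lambda>\<xi>. k \<xi> * f \<xi>) integrable_on {0..1}" if "continuous_on {0..1} k" for k
    by (rule set_lebesgue_integral_eq_integral(1)[OF absolutely_integrable_continuous_mult[OF that f]])
  have ints: "(\<lambda>\<xi>. sin (s * (y - \<xi>)) / s * f \<xi>) integrable_on {0..1}"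
    "(\<lambda>\<xi>. cos (s * (y - \<xi>)) / s * f \<xi>) integrable_on {0..1}" for y
    using s_pos by (auto intro!: int continuous_intros)
  txt \<open>Solvability: eliminating the unknown leaves \<open>T f 1\<close>, a nonzero multiple of the integral of \<open>f u0\<close>.\<close>
  have compat: "P * cos ?B + N * sin ?B + \<beta> / s * sin ?B * Z = 0"
  proof -
    have Zint: "((\<lambda>\<xi>. if \<xi> \<in> {0..\<alpha>} then sin (s * (\<alpha> - \<xi>)) / s * f \<xi> else 0) has_integral Z) {0..1}"
    proof (rule has_integral_restrict[THEN iffD2])
      show "((\<lambda>\<xi>. sin (s * (\<alpha> - \<xi>)) / s * f \<xi>) has_integral Z) {0..\<alpha>}"
        unfolding Z_def z_def
        by (intro integrable_integral integrable_subinterval_real[OF ints(1)]) (use \<alpha>1 in auto)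
    qed (use \<alpha>1 in auto)
    have "((\<lambda>\<xi>. s * c0 * (sin (s * (\<alpha> - \<xi>)) / s * f \<xi> * cos ?B + cos (s * (\<alpha> - \<xi>)) / s * f \<xi> * sin ?B
      + \<beta> / s * sin ?B * (if \<xi> \<in> {0..\<alpha>} then sin (s * (\<alpha> - \<xi>)) / s * f \<xi> else 0)))
      has_integral s * c0 * (P * cos ?B + N * sin ?B + \<beta> / s * sin ?B * Z)) {0..1}"
      unfolding P_def N_def
      by (intro has_integral_mult_right has_integral_add has_integral_mult_left integrable_integral ints Zint)
    moreover have "s * c0 * (sin (s * (\<alpha> - \<xi>)) / s * f \<xi> * cos ?B + cos (s * (\<alpha> - \<xi>)) / s * f \<xi> * sin ?B
      + \<beta> / s * sin ?B * (if \<xi> \<in> {0..\<alpha>} then sin (s * (\<alpha> - \<xi>)) / s * f \<xi> else 0)) = f \<xi> * u0 \<xi>"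
      if \<xi>: "\<xi> \<in> {0..1}" for \<xi>
    proof -
      define t where "t = s * (\<alpha> - \<xi>)"
      have u0c: "u0 \<xi> = c0 * (sin t * cos ?B + cos t * sin ?B + (if \<xi> \<le> \<alpha> then \<beta> / s * sin ?B * sin t else 0))"
      proof (cases "\<xi> \<le> \<alpha>")
        case True
        have "s * u0 \<xi> = sin (s * \<alpha> - t)" using True s_pos by (simp add: fd_u0_def t_def algebra_simps)
        also have "\<dots> = sin (s * \<alpha>) * cos t - (cos (s * \<alpha>) + \<beta> / s * sin (s * \<alpha>)) * sin t + \<beta> / s * sin (s * \<alpha>) * sin t"
          by (simp add: sin_diff algebra_simps)
        also have "\<dots> = s * c0 * sin ?B * cos t + s * c0 * cos ?B * sin t + \<beta> / s * (s * c0 * sin ?B) * sin t"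
        proof -
          have "x * c - y * w + D * x * w = x * c + - y * w + D * x * w" for x y c w D :: real by simp
          then show ?thesis unfolding amplitude_sin amplitude_cos .
        qed
        also have "\<dots> = s * (c0 * (sin t * cos ?B + cos t * sin ?B + \<beta> / s * sin ?B * sin t))"
          by (simp only: distrib_left ac_simps)
        finally show ?thesis using True s_pos by simp
      next
        case False
        have "s * (1 - \<xi>) = t + ?B" by (simp add: t_def algebra_simps)
        then show ?thesis using False by (simp add: u0_right sin_add)
      qed
      show ?thesis unfolding t_def[symmetric] u0c using s_pos \<xi> by (simp add: field_simps)
    qed
    ultimately have "((\<lambda>\<xi>. f \<xi> * u0 \<xi>) has_integral s * c0 * (P * cos ?B + N * sin ?B + \<beta> / s * sin ?B * Z)) {0..1}"
      by (rule has_integral_eq[rotated])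
    then have "s * c0 * (P * cos ?B + N * sin ?B + \<beta> / s * sin ?B * Z) = 0"
      using orth by (simp add: integral_unique)
    then show ?thesis using s_pos c0_nonzero by simp
  qed
  \<comment> \<open>The only candidate: multiply the two equations by the sine and the cosine of
    \<open>?B\<close> and add.\<close>
  define d where "d = P * sin ?B - (N + \<beta> / s * Z) * cos ?B"
  have one: "sin ?B * sin ?B = 1 - cos ?B * cos ?B"
    using sin_cos_squared_add[of ?B] by (simp add: power2_eq_square)
  have dP: "d * sin ?B = P"
  proof -
    have "d * sin ?B = P * (sin ?B * sin ?B) - (N * sin ?B + \<beta> / s * sin ?B * Z) * cos ?B"
      by (simp add: d_def algebra_simps)
    also have "N * sin ?B + \<beta> / s * sin ?B * Z = - P * cos ?B" using compat by linarith
    finally show ?thesis unfolding one by (simp add: algebra_simps)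
  qed
  have dN: "d * cos ?B = - N - \<beta> / s * Z"
  proof -
    have "d * cos ?B = (P * cos ?B) * sin ?B - (N + \<beta> / s * Z) * (cos ?B * cos ?B)"
      by (simp add: d_def algebra_simps)
    also have "P * cos ?B = - (N + \<beta> / s * Z) * sin ?B" using compat by (simp add: algebra_simps)
    also have "cos ?B * cos ?B = 1 - sin ?B * sin ?B" using one by simp
    finally show ?thesis by (simp add: algebra_simps)
  qed
  have "c1 = d"
    unfolding c1_def P_def[symmetric] N_def[symmetric] Z'
  proof (rule the_equality)
    show "d * sin ?B = P \<and> d * cos ?B = - N - \<beta> * (Z / s)" using dP dN by simp
    fix e assume "e * sin ?B = P \<and> e * cos ?B = - N - \<beta> * (Z / s)"
    then have "e * sin ?B = d * sin ?B" "e * cos ?B = d * cos ?B" unfolding dP dN by simp_all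
    then show "e = d" using one by auto
  qed
  show ?thesis
  proof (cases "x \<le> \<alpha>")
    case True
    then show ?thesis by (simp add: T_def J_def z_def)
  next
    case False
    \<comment> \<open>The integral over x..1 is the full integral minus \<open>z f x\<close>. The
      full integral cancels against the term with the constant, except for the multiple of
      \<open>Z\<close> that \<open>T\<close> adds beyond \<alpha>.\<close>
    let ?t = "s * (x - \<alpha>)"
    have "((\<lambda>\<xi>. sin ?t * (cos (s * (\<alpha> - \<xi>)) / s * f \<xi>) + cos ?t * (sin (s * (\<alpha> - \<xi>)) / s * f \<xi>))
      has_integral sin ?t * N + cos ?t * P) {0..1}"
      unfolding P_def N_def by (intro has_integral_add has_integral_mult_right integrable_integral ints)
    moreover have "sin ?t * (cos (s * (\<alpha> - \<xi>)) / s * f \<xi>) + cos ?t * (sin (s * (\<alpha> - \<xi>)) / s * f \<xi>) =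
      sin (s * (x - \<xi>)) / s * f \<xi>" for \<xi>
    proof -
      have "s * (x - \<xi>) = ?t + s * (\<alpha> - \<xi>)" by (simp add: algebra_simps)
      then show ?thesis using sin_add[of ?t "s * (\<alpha> - \<xi>)"] by (simp add: add_divide_distrib distrib_right)
    qed
    ultimately have "((\<lambda>\<xi>. sin (s * (x - \<xi>)) / s * f \<xi>) has_integral sin ?t * N + cos ?t * P) {0..1}"
      by (simp only:)
    then have full: "integral {0..1} (\<lambda>\<xi>. sin (s * (x - \<xi>)) / s * f \<xi>) = sin ?t * N + cos ?t * P"
      by (rule integral_unique)
    have comb: "z f x + integral {x..1} (\<lambda>\<xi>. sin (s * (x - \<xi>)) / s * f \<xi>) = sin ?t * N + cos ?t * P"
      unfolding z_def full[symmetric] using x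
      by (intro Henstock_Kurzweil_Integration.integral_combine ints) auto
    have "d * sin (s * (1 - x)) = (d * sin ?B) * cos ?t - (d * cos ?B) * sin ?t"
    proof -
      have "s * (1 - x) = ?B - ?t" by (simp add: algebra_simps)
      moreover have "e * (x * y - w * v) = e * x * y - e * w * v" for e x y w v :: real
        by (simp add: algebra_simps)
      ultimately show ?thesis by (simp only: sin_diff[of ?B ?t])
    qed
    also have "\<dots> = P * cos ?t + (N + \<beta> / s * Z) * sin ?t" unfolding dP dN by (simp add: algebra_simps)
    finally have "d * sin (s * (1 - x)) = P * cos ?t + (N + \<beta> / s * Z) * sin ?t" .
    then show ?thesis using False comb \<open>c1 = d\<close>
      by (simp add: T_def J_def Z_def algebra_simps)
  qed
qed

section \<open>Recursive estimates for the corrections\<close>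

abbreviation "a p \<equiv> norm_inf (u p)"
abbreviation "Q \<equiv> norm_L1 q"

lemma u_0: "u 0 = u0" by (rule ext) simp

lemma F_integrable:
  assumes "\<And>p. p \<le> k \<Longrightarrow> continuous_on {0..1} (u p)"
  shows "F (Suc k) absolutely_integrable_on {0..1}"
proof -
  have "(\<lambda>x. - (\<Sum>p=0..k. lam (Suc k - p) * u p x)) absolutely_integrable_on {0..1}"
    by (intro absolutely_integrable_continuous_real continuous_intros assms) auto
  moreover have "(\<lambda>x. u k x * q x) absolutely_integrable_on {0..1}"
    by (intro absolutely_integrable_continuous_mult assms q) auto
  ultimately have "(\<lambda>x. - (\<Sum>p=0..k. lam (Suc k - p) * u p x) + u k x * q x) absolutely_integrable_on {0..1}"
    by (rule set_integral_add(1))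
  then show ?thesis unfolding fd_F.simps(2)[abs_def] by (simp only: mult.commute[of "q _"])
qed

lemma F_orthogonal:
  assumes cont: "\<And>p. p \<le> k \<Longrightarrow> continuous_on {0..1} (u p)"
  shows "integral {0..1} (\<lambda>x. F (Suc k) x * u0 x) = 0"
proof -
  define I where "I p = integral {0..1} (\<lambda>\<xi>. u0 \<xi> * u p \<xi>)" for p
  define K where "K = integral {0..1} (\<lambda>\<xi>. q \<xi> * u k \<xi> * u0 \<xi>)"
  have I: "((\<lambda>\<xi>. u0 \<xi> * u p \<xi>) has_integral I p) {0..1}" if "p \<le> k" for p
    unfolding I_def by (intro integrable_integral integrable_continuous_real continuous_intros continuous_u0 cont that)
  have "(\<lambda>\<xi>. (u k \<xi> * u0 \<xi>) * q \<xi>) absolutely_integrable_on {0..1}"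
    by (intro absolutely_integrable_continuous_mult continuous_intros continuous_u0 cont q) auto
  then have "(\<lambda>\<xi>. (u k \<xi> * u0 \<xi>) * q \<xi>) integrable_on {0..1}" by (rule set_lebesgue_integral_eq_integral(1))
  then have K: "((\<lambda>\<xi>. q \<xi> * u k \<xi> * u0 \<xi>) has_integral K) {0..1}"
    unfolding K_def by (intro integrable_integral) (simp add: mult_ac)
  have "((\<lambda>x. - (\<Sum>p=0..k. lam (Suc k - p) * (u0 x * u p x)) + q x * u k x * u0 x) has_integral
    - (\<Sum>p=0..k. lam (Suc k - p) * I p) + K) {0..1}"
    by (intro has_integral_add has_integral_neg has_integral_sum has_integral_mult_right I K) auto
  moreover have "- (\<Sum>p=0..k. lam (Suc k - p) * (u0 x * u p x)) + q x * u k x * u0 x = F (Suc k) x * u0 x" for x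
    by (simp add: fd_F.simps(2) sum_distrib_left sum_distrib_right algebra_simps)
  ultimately have "integral {0..1} (\<lambda>x. F (Suc k) x * u0 x) = - (\<Sum>p=0..k. lam (Suc k - p) * I p) + K"
    by (intro integral_unique) (simp only:)
  also have "(\<Sum>p=0..k. lam (Suc k - p) * I p) = lam (Suc k) * I 0 + (\<Sum>p=1..k. lam (Suc k - p) * I p)"
    by (simp add: sum.atLeast_Suc_atMost)
  \<comment> \<open>\<open>I 0\<close> is the integral of the square of \<open>u0\<close>, so lam0 /
    M normalizes it to 1, and the new coefficient cancels everything else.\<close>
  also have "lam (Suc k) * I 0 = - (\<Sum>p=1..k. lam (Suc k - p) * I p) + K"
  proof -
    have "lam0 / M * I 0 = 1"
    proof -
      have "I 0 = integral {0..1} (\<lambda>\<xi>. (u0 \<xi>)\<^sup>2)" unfolding I_def u_0 power2_eq_square ..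
      then have "lam0 * I 0 = M" unfolding fd_M_def by simp
      then show ?thesis using M_pos by simp
    qed
    then have "X = lam0 / M * X * I 0" for X
      by (metis mult.assoc mult.commute mult_1)
    then show ?thesis unfolding fd_lam.simps(2) I_def[symmetric] K_def[symmetric] by (rule sym)
  qed
  finally show ?thesis by simp
qed

lemma u_Suc_T:
  assumes "\<And>p. p \<le> k \<Longrightarrow> continuous_on {0..1} (u p)" and "x \<in> {0..1}"
  shows "u (Suc k) x = T (F (Suc k)) x"
proof -
  have "F (Suc k) absolutely_integrable_on {0..1}" "integral {0..1} (\<lambda>x. F (Suc k) x * u0 x) = 0"
    using F_integrable[of k] F_orthogonal[of k] assms(1) by blast+
  from fd_T_formula[OF this assms(2)] show ?thesis unfolding fd_u.simps(2) fd_c.simps(2) .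
qed

text \<open>Strong induction, because the identity with \<open>T\<close> presupposes continuity of
  all earlier corrections. Through that identity continuity also holds at \<alpha>, where the two
  branches meet.\<close>

lemma continuous_u: "continuous_on {0..1} (u k)"
proof (induction k rule: less_induct)
  case (less k)
  show ?case
  proof (cases k)
    case 0
    then show ?thesis by (simp add: u_0 continuous_u0)
  next
    case (Suc j)
    then have "continuous_on {0..1} (u p)" if "p \<le> j" for p using less that by simp
    then have "continuous_on {0..1} (T (F (Suc j)))" "\<And>x. x \<in> {0..1} \<Longrightarrow> T (F (Suc j)) x = u (Suc j) x"
      using continuous_T F_integrable u_Suc_T by simp_all
    then show ?thesis unfolding Suc by (rule continuous_on_eq)
  qed
qed

lemmas F_abs_integrable = F_integrable[OF continuous_u]
lemmas u_eq_T = u_Suc_T[OF continuous_u]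
lemmas abs_u_le = abs_le_norm_inf[OF continuous_u]
lemmas a_nonneg = norm_inf_nonneg[OF continuous_u]

lemma abs_F_le:
  assumes "x \<in> {0..1}"
  shows "\<bar>F (Suc k) x\<bar> \<le> (\<Sum>p=0..k. \<bar>lam (Suc k - p)\<bar> * a p) + a k * \<bar>q x\<bar>"
proof -
  have "\<bar>F (Suc k) x\<bar> \<le> \<bar>\<Sum>p=0..k. lam (Suc k - p) * u p x\<bar> + \<bar>u k x\<bar> * \<bar>q x\<bar>"
    unfolding fd_F.simps(2) by (simp only: mult.commute[of "q x"] flip: abs_mult)
  also have "\<bar>\<Sum>p=0..k. lam (Suc k - p) * u p x\<bar> \<le> (\<Sum>p=0..k. \<bar>lam (Suc k - p)\<bar> * a p)"
    by (rule order_trans[OF sum_abs sum_mono]) (auto simp: abs_mult intro!: mult_left_mono abs_u_le assms)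
  also have "\<bar>u k x\<bar> * \<bar>q x\<bar> \<le> a k * \<bar>q x\<bar>" by (intro mult_right_mono abs_u_le assms) simp
  finally show ?thesis by simp
qed

lemma abs_q_integrable: "(\<lambda>x. \<bar>q x\<bar>) integrable_on {0..1}"
  using q by (simp add: absolutely_integrable_on_def)

lemma norm_L1_F_le: "norm_L1 (F (Suc k)) \<le> (\<Sum>p=0..k. \<bar>lam (Suc k - p)\<bar> * a p) + a k * Q"
proof -
  define S where "S = (\<Sum>p=0..k. \<bar>lam (Suc k - p)\<bar> * a p)"
  have "norm_L1 (F (Suc k)) \<le> integral {0..1} (\<lambda>x. S + a k * \<bar>q x\<bar>)"
    unfolding norm_L1_def
  proof (rule integral_le)
    show "(\<lambda>x. \<bar>F (Suc k) x\<bar>) integrable_on {0..1}"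
      using F_abs_integrable by (simp add: absolutely_integrable_on_def)
    show "(\<lambda>x. S + a k * \<bar>q x\<bar>) integrable_on {0..1}"
      by (intro integrable_add integrable_on_mult_right abs_q_integrable) auto
  qed (use abs_F_le in \<open>simp add: S_def\<close>)
  also have "\<dots> = S + a k * Q"
    unfolding norm_L1_def
    by (subst Henstock_Kurzweil_Integration.integral_add)
      (auto intro!: integrable_on_mult_right abs_q_integrable)
  finally show ?thesis unfolding S_def .
qed

lemma abs_lam_Suc_le:
  "\<bar>lam (Suc k)\<bar> \<le> b * ((\<Sum>p=1..k. \<bar>lam (Suc k - p)\<bar> * a p) + Q * a k)"
proof -
  define I where "I p = integral {0..1} (\<lambda>\<xi>. u0 \<xi> * u p \<xi>)" for p
  define K where "K = integral {0..1} (\<lambda>\<xi>. q \<xi> * u k \<xi> * u0 \<xi>)"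
  have u0_le: "\<bar>u0 x\<bar> \<le> norm_inf u0" if "x \<in> {0..1}" for x
    by (rule abs_le_norm_inf[OF continuous_u0 that])
  have I: "\<bar>I p\<bar> \<le> norm_inf u0 * a p" for p
  proof -
    have "norm (I p) \<le> integral {0..1} (\<lambda>x::real. norm_inf u0 * a p)"
      unfolding I_def
    proof (rule integral_norm_bound_integral)
      show "(\<lambda>\<xi>. u0 \<xi> * u p \<xi>) integrable_on {0..1}"
        by (intro integrable_continuous_real continuous_intros continuous_u0 continuous_u)
      fix x :: real assume x: "x \<in> {0..1}"
      show "norm (u0 x * u p x) \<le> norm_inf u0 * a p"
        unfolding real_norm_def abs_mult
        by (intro mult_mono u0_le abs_u_le x) (use norm_inf_u0_pos in auto)
    qed auto
    then show ?thesis by simp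
  qed
  have K: "\<bar>K\<bar> \<le> norm_inf u0 * (Q * a k)"
  proof -
    have "(\<lambda>\<xi>. (u k \<xi> * u0 \<xi>) * q \<xi>) absolutely_integrable_on {0..1}"
      by (intro absolutely_integrable_continuous_mult continuous_intros continuous_u0 continuous_u q)
    then have Ki: "(\<lambda>\<xi>. (u k \<xi> * u0 \<xi>) * q \<xi>) integrable_on {0..1}" by (rule set_lebesgue_integral_eq_integral(1))
    have "norm K \<le> integral {0..1} (\<lambda>x. (a k * norm_inf u0) * \<bar>q x\<bar>)"
      unfolding K_def
    proof (rule integral_norm_bound_integral)
      show "(\<lambda>\<xi>. q \<xi> * u k \<xi> * u0 \<xi>) integrable_on {0..1}" using Ki by (simp add: mult_ac)
      show "(\<lambda>x. (a k * norm_inf u0) * \<bar>q x\<bar>) integrable_on {0..1}"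
        by (intro integrable_on_mult_right abs_q_integrable)
      fix x :: real assume x: "x \<in> {0..1}"
      have "\<bar>u k x\<bar> * \<bar>u0 x\<bar> * \<bar>q x\<bar> \<le> (a k * norm_inf u0) * \<bar>q x\<bar>"
        by (intro mult_mono u0_le abs_u_le x a_nonneg mult_nonneg_nonneg) (use norm_inf_u0_pos in auto)
      then show "norm (q x * u k x * u0 x) \<le> (a k * norm_inf u0) * \<bar>q x\<bar>"
        by (simp add: abs_mult mult_ac)
    qed
    then show ?thesis by (simp add: norm_L1_def mult_ac)
  qed
  have "\<bar>lam (Suc k)\<bar> = lam0 / M * \<bar>- (\<Sum>p=1..k. lam (Suc k - p) * I p) + K\<bar>"
    unfolding fd_lam.simps(2) I_def[symmetric] K_def[symmetric] abs_mult
    using M_pos by (simp add: lam0_eq)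
  also have "\<dots> \<le> lam0 / M * ((\<Sum>p=1..k. \<bar>lam (Suc k - p)\<bar> * (norm_inf u0 * a p)) + norm_inf u0 * (Q * a k))"
  proof (rule mult_left_mono)
    have "\<bar>\<Sum>p=1..k. lam (Suc k - p) * I p\<bar> \<le> (\<Sum>p=1..k. \<bar>lam (Suc k - p)\<bar> * (norm_inf u0 * a p))"
      by (rule order_trans[OF sum_abs sum_mono]) (simp add: abs_mult mult_left_mono I)
    then show "\<bar>- (\<Sum>p=1..k. lam (Suc k - p) * I p) + K\<bar> \<le>
      (\<Sum>p=1..k. \<bar>lam (Suc k - p)\<bar> * (norm_inf u0 * a p)) + norm_inf u0 * (Q * a k)"
      using K by linarith
  qed (use M_pos in \<open>simp add: lam0_eq\<close>)
  also have "\<dots> = lam0 / M * norm_inf u0 * ((\<Sum>p=1..k. \<bar>lam (Suc k - p)\<bar> * a p) + Q * a k)"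
  proof -
    have "(\<Sum>p=1..k. \<bar>lam (Suc k - p)\<bar> * (norm_inf u0 * a p)) = norm_inf u0 * (\<Sum>p=1..k. \<bar>lam (Suc k - p)\<bar> * a p)"
      unfolding sum_distrib_left by (rule sum.cong) (simp_all only: ac_simps)
    then show ?thesis by (simp only: distrib_left mult.assoc)
  qed
  also have "\<dots> \<le> b * ((\<Sum>p=1..k. \<bar>lam (Suc k - p)\<bar> * a p) + Q * a k)"
    by (intro mult_right_mono lam0_M_norm_u0_le add_nonneg_nonneg sum_nonneg mult_nonneg_nonneg norm_L1_nonneg a_nonneg) auto
  finally show ?thesis .
qed

definition G :: real where
  "G = (1 + sqrt (1 + (1 + \<beta> / s)\<^sup>2)) / s"

definition \<rho> :: real where
  "\<rho> = 1 + 2 * v0 - 2 * sqrt (v0 * (1 + v0))"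

text \<open>\<open>abs_T_le\<close> gives the better factor \<open>(1 + \<beta> / s) / s\<close>; \<open>G\<close> is the one occurring in \<open>fd_r\<close>.\<close>

lemma a_Suc_le: "a (Suc k) \<le> G * ((\<Sum>p=0..k. \<bar>lam (Suc k - p)\<bar> * a p) + a k * Q)"
proof (rule norm_inf_le)
  fix x :: real assume x: "x \<in> {0..1}"
  have "\<bar>u (Suc k) x\<bar> \<le> (1 + \<beta> / s) / s * norm_L1 (F (Suc k))"
    unfolding u_eq_T[OF x] by (rule abs_T_le[OF F_abs_integrable x])
  also have "\<dots> \<le> G * ((\<Sum>p=0..k. \<bar>lam (Suc k - p)\<bar> * a p) + a k * Q)"
  proof (intro mult_mono norm_L1_F_le norm_L1_nonneg)
    have "1 + \<beta> / s \<le> sqrt (1 + (1 + \<beta> / s)\<^sup>2)" by (rule real_le_rsqrt) simp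
    then show "(1 + \<beta> / s) / s \<le> G" unfolding G_def using s_pos by (intro divide_right_mono) auto
    show "0 \<le> G" unfolding G_def using s_pos by simp
  qed
  finally show "\<bar>u (Suc k) x\<bar> \<le> G * ((\<Sum>p=0..k. \<bar>lam (Suc k - p)\<bar> * a p) + a k * Q)" .
qed

lemma G_pos: "G > 0" unfolding G_def using s_pos by (simp add: add_pos_nonneg)

text \<open>Holds for Q = 0 too: then \<open>fd_R\<close> is 0, and both sides are 0.\<close>

lemma r_eq: "fd_r \<alpha> \<beta> q n = G * Q * (1 + v0) / \<rho>"
  unfolding fd_r_def fd_R_def G_def \<rho>_def by (simp add: field_simps)

text \<open>After multiplication by \<open>b\<close>, the norms \<open>a k\<close> and the numbers
  |\<open>lam k\<close>| satisfy inequalities whose convolution is that of the majorant g, and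
  powers of Q and E factor out. The ratio r is E / \<rho>, with \<rho> from the bound on g.\<close>

lemma fd_coefficient_bounds:
  defines "r \<equiv> fd_r \<alpha> \<beta> q n"
  shows "\<rho> > 0" "r \<ge> 0"
    and "b * a (Suc k) \<le> fd_alpha (Suc k) * r ^ Suc k"
    and "\<bar>lam (Suc k)\<bar> \<le> Q / \<rho> * (fd_alpha (Suc k) * r ^ k)"
proof -
  obtain g where g0: "g 0 = v0" and \<rho>: "0 < \<rho>"
    and g: "\<And>k. g (Suc k) = (\<Sum>p=1..k. g (Suc k - p) * g p) + g k"
    and g_le: "\<And>j. j \<ge> 1 \<Longrightarrow> g j \<le> fd_alpha j / \<rho> ^ j"
    using fd_majorant[OF v0_pos] unfolding \<rho>_def[symmetric] by metis
  \<comment> \<open>One step of the eigenfunction recursion costs G for solving the equation, Q for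
    the potential, and 1 + \<open>v0\<close> for the term with the new eigenvalue
    correction.\<close>
  define E where "E = G * Q * (1 + v0)"
  have Q: "Q \<ge> 0" by (rule norm_L1_nonneg)
  have E: "E \<ge> 0" unfolding E_def using G_pos Q v0_pos by simp
  have b: "b > 0" using b_ge(1) by linarith
  \<comment> \<open>The eigenvalue corrections carry Q and one power of E less, since their
    recursion does not solve a differential equation.\<close>
  have main: "b * a k \<le> E ^ k * g k \<and> (\<forall>j. k = Suc j \<longrightarrow> \<bar>lam k\<bar> \<le> Q * E ^ j * g k)" for k
  proof (induction k rule: less_induct)
    case (less k)
    show ?case
    proof (cases k)
      case 0
      then show ?thesis by (simp add: g0 u_0 fd_v0_def)
    next
      case (Suc j)
      have A: "b * a p \<le> E ^ p * g p" if "p \<le> j" for p using less that Suc by simp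
      have L: "\<bar>lam (Suc j - p)\<bar> \<le> Q * E ^ (j - p) * g (Suc j - p)" if "p \<in> {1..j}" for p
      proof -
        have "Suc j - p = Suc (j - p)" "Suc (j - p) < k" using that Suc by auto
        then show ?thesis using less[of "Suc (j - p)"] by simp
      qed
      define S where "S = (\<Sum>p=1..j. \<bar>lam (Suc j - p)\<bar> * (b * a p)) + Q * (b * a j)"
      have S: "S \<le> Q * E ^ j * g (Suc j)"
      proof -
        have "S \<le> (\<Sum>p=1..j. Q * E ^ (j - p) * g (Suc j - p) * (E ^ p * g p)) + Q * (E ^ j * g j)"
          unfolding S_def
        proof (rule add_mono, rule sum_mono)
          fix p assume p: "p \<in> {1..j}"
          have A': "b * a p \<le> E ^ p * g p" using A p by simp
          show "\<bar>lam (Suc j - p)\<bar> * (b * a p) \<le> Q * E ^ (j - p) * g (Suc j - p) * (E ^ p * g p)"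
            by (rule mult_mono[OF L[OF p] A' order_trans[OF abs_ge_zero L[OF p]]]) (use b a_nonneg in simp)
        qed (use Q A in \<open>auto intro: mult_left_mono\<close>)
        also have "\<dots> = Q * E ^ j * ((\<Sum>p=1..j. g (Suc j - p) * g p) + g j)"
        proof -
          have "Q * E ^ (j - p) * g (Suc j - p) * (E ^ p * g p) = Q * E ^ j * (g (Suc j - p) * g p)"
            if "p \<in> {1..j}" for p
          proof -
            have "E ^ j = E ^ (j - p) * E ^ p" using that by (simp flip: power_add)
            then show ?thesis by (simp only: ac_simps)
          qed
          then have "(\<Sum>p=1..j. Q * E ^ (j - p) * g (Suc j - p) * (E ^ p * g p)) =
            (\<Sum>p=1..j. Q * E ^ j * (g (Suc j - p) * g p))" by (intro sum.cong refl)
          then show ?thesis by (simp only: distrib_left sum_distrib_left mult.assoc)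
        qed
        finally show ?thesis unfolding g[of j] .
      qed
      have bS: "b * ((\<Sum>p=1..j. \<bar>lam (Suc j - p)\<bar> * a p) + Q * a j) = S"
        unfolding S_def distrib_left sum_distrib_left by (simp add: mult_ac)
      have lam: "\<bar>lam (Suc j)\<bar> \<le> S" using abs_lam_Suc_le[of j] unfolding bS .
      have "b * a (Suc j) \<le> b * (G * ((\<Sum>p=0..j. \<bar>lam (Suc j - p)\<bar> * a p) + a j * Q))"
        using a_Suc_le[of j] b by (intro mult_left_mono) auto
      \<comment> \<open>The term p = 0 contains the new eigenvalue correction, which S already
        bounds; with b * a 0 = v0 the bracket is at most 1 + \<open>v0\<close> times the bound for
        S.\<close>
      also have "\<dots> = G * (\<bar>lam (Suc j)\<bar> * v0 + b * ((\<Sum>p=1..j. \<bar>lam (Suc j - p)\<bar> * a p) + Q * a j))"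
      proof -
        have split: "(\<Sum>p=0..j. \<bar>lam (Suc j - p)\<bar> * a p) = \<bar>lam (Suc j)\<bar> * a 0 + (\<Sum>p=1..j. \<bar>lam (Suc j - p)\<bar> * a p)"
          by (simp add: sum.atLeast_Suc_atMost)
        have "v0 = b * a 0" by (simp add: fd_v0_def u_0)
        then show ?thesis unfolding split by (simp only: distrib_left ac_simps)
      qed
      also have "\<dots> = G * (\<bar>lam (Suc j)\<bar> * v0 + S)" unfolding bS ..
      also have "\<dots> \<le> G * (Q * E ^ j * g (Suc j) * v0 + Q * E ^ j * g (Suc j))"
        using G_pos v0_pos S lam by (intro mult_left_mono add_mono mult_right_mono) auto
      also have "\<dots> = E ^ Suc j * g (Suc j)" by (simp add: E_def algebra_simps)
      finally have "b * a (Suc j) \<le> E ^ Suc j * g (Suc j)" .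
      moreover have "\<bar>lam (Suc j)\<bar> \<le> Q * E ^ j * g (Suc j)" using lam S by (rule order_trans)
      ultimately show ?thesis unfolding Suc by blast
    qed
  qed
  have r: "r = E / \<rho>" unfolding r_def r_eq E_def ..
  show "\<rho> > 0" by (rule \<rho>)
  show "r \<ge> 0" unfolding r using E \<rho> by simp
  have "E ^ Suc k * g (Suc k) \<le> E ^ Suc k * (fd_alpha (Suc k) / \<rho> ^ Suc k)"
    using E by (intro mult_left_mono g_le) auto
  also have "\<dots> = fd_alpha (Suc k) * r ^ Suc k" unfolding r power_divide by simp
  finally show "b * a (Suc k) \<le> fd_alpha (Suc k) * r ^ Suc k" using main[of "Suc k"] by linarith
  have "\<bar>lam (Suc k)\<bar> \<le> Q * E ^ k * g (Suc k)" using main[of "Suc k"] by blast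
  also have "\<dots> \<le> Q * E ^ k * (fd_alpha (Suc k) / \<rho> ^ Suc k)"
    using E Q by (intro mult_left_mono g_le) auto
  also have "\<dots> = Q / \<rho> * (fd_alpha (Suc k) * r ^ k)" unfolding r power_divide by simp
  finally show "\<bar>lam (Suc k)\<bar> \<le> Q / \<rho> * (fd_alpha (Suc k) * r ^ k)" .
qed

end

section \<open>The limit\<close>

locale fd_convergent = fd_problem +
  assumes r1: "fd_r \<alpha> \<beta> q n < 1"
begin

abbreviation "r \<equiv> fd_r \<alpha> \<beta> q n"
abbreviation "\<Lambda> \<equiv> (\<Sum>j. lam j)"

definition U :: "real \<Rightarrow> real" where "U x = (\<Sum>j. u j x)"
text \<open>The right-hand side obtained when the limit equation is written as U'' + s^2 U = Fl,
  that is, with the unperturbed operator on the left.\<close>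

definition Fl :: "real \<Rightarrow> real" where "Fl x = (lam0 - \<Lambda>) * U x + q x * U x"

lemma b_pos: "b > 0" using b_ge(1) by linarith

lemma K_nonneg: "Q / \<rho> \<ge> 0" "r / b \<ge> 0"
  using norm_L1_nonneg fd_coefficient_bounds(1,2) b_pos by simp_all

lemma a_Suc_bound: "a (Suc k) \<le> r / b * (fd_alpha (Suc k) * r ^ k)"
proof -
  have "a (Suc k) = b * a (Suc k) / b" using b_pos by simp
  also have "\<dots> \<le> fd_alpha (Suc k) * r ^ Suc k / b"
    using b_pos fd_coefficient_bounds(3) by (intro divide_right_mono) auto
  finally show ?thesis by (simp add: mult_ac)
qed

lemma summable_abs_lam: "summable (\<lambda>j. \<bar>lam j\<bar>)"
  and lam_tail: "\<bar>\<Lambda> - (\<Sum>j\<le>m. lam j)\<bar> \<le> Q / \<rho> * (fd_alpha (Suc m) * r ^ m) / (1 - r)"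
  using fd_alpha_geometric_tail[OF fd_coefficient_bounds(2) r1 K_nonneg(1) fd_coefficient_bounds(4)] by blast+

lemma summable_lam: "summable lam" using summable_abs_lam by (rule summable_rabs_cancel)

lemma summable_a: "summable a"
proof -
  have "\<bar>a (Suc k)\<bar> \<le> r / b * (fd_alpha (Suc k) * r ^ k)" for k using a_Suc_bound a_nonneg by simp
  from fd_alpha_geometric_tail(1)[OF fd_coefficient_bounds(2) r1 K_nonneg(2) this] show ?thesis
    using a_nonneg by simp
qed

lemma summable_abs_u: "x \<in> {0..1} \<Longrightarrow> summable (\<lambda>j. \<bar>u j x\<bar>)"
  and u_tail: "x \<in> {0..1} \<Longrightarrow> \<bar>U x - (\<Sum>j\<le>m. u j x)\<bar> \<le> r / b * (fd_alpha (Suc m) * r ^ m) / (1 - r)"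
proof -
  assume x: "x \<in> {0..1}"
  have "\<bar>u (Suc k) x\<bar> \<le> r / b * (fd_alpha (Suc k) * r ^ k)" for k
    using abs_u_le[OF x] a_Suc_bound by (rule order_trans)
  from fd_alpha_geometric_tail[OF fd_coefficient_bounds(2) r1 K_nonneg(2) this]
  show "summable (\<lambda>j. \<bar>u j x\<bar>)" "\<bar>U x - (\<Sum>j\<le>m. u j x)\<bar> \<le> r / b * (fd_alpha (Suc m) * r ^ m) / (1 - r)"
    unfolding U_def by blast+
qed

lemma u_sums: "x \<in> {0..1} \<Longrightarrow> (\<lambda>j. u j x) sums U x"
  unfolding U_def by (rule summable_sums[OF summable_rabs_cancel[OF summable_abs_u]])

lemma uniform_limit_u: "uniform_limit {0..1} (\<lambda>m x. \<Sum>j\<le>m. u j x) U sequentially"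
proof (rule uniform_limitI)
  fix e :: real assume "e > 0"
  \<comment> \<open>1 / 4 is \<open>fd_alpha 1\<close>, which bounds all weights from index 1
    on.\<close>
  have "(\<lambda>m. r / b * (1 / 4) / (1 - r) * r ^ m) \<longlonglongrightarrow> r / b * (1 / 4) / (1 - r) * 0"
    using fd_coefficient_bounds(2) r1 by (intro tendsto_intros LIMSEQ_realpow_zero)
  then have "\<forall>\<^sub>F m in sequentially. r / b * (1 / 4) / (1 - r) * r ^ m < e"
    using \<open>e > 0\<close> by (intro order_tendstoD(2)) auto
  then show "\<forall>\<^sub>F m in sequentially. \<forall>x\<in>{0..1}. dist (\<Sum>j\<le>m. u j x) (U x) < e"
  proof eventually_elim
    case (elim m)
    show ?case
    proof
      fix x :: real assume x: "x \<in> {0..1}"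
      have "dist (\<Sum>j\<le>m. u j x) (U x) \<le> r / b * (fd_alpha (Suc m) * r ^ m) / (1 - r)"
        using u_tail[OF x, of m] by (simp add: dist_real_def abs_minus_commute)
      also have "\<dots> \<le> r / b * (1 / 4 * r ^ m) / (1 - r)"
        using K_nonneg(2) fd_coefficient_bounds(2) r1 fd_alpha_antimono[of 1 "Suc m"] fd_alpha_1
        by (intro divide_right_mono mult_left_mono mult_right_mono) auto
      also have "\<dots> < e" using elim by simp
      finally show "dist (\<Sum>j\<le>m. u j x) (U x) < e" .
    qed
  qed
qed

lemma continuous_U: "continuous_on {0..1} U"
  by (rule uniform_limit_theorem[OF _ uniform_limit_u])
    (auto intro!: always_eventually continuous_intros continuous_u)

lemma Fl_abs_integrable: "Fl absolutely_integrable_on {0..1}"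
proof -
  have "(\<lambda>x. (lam0 - \<Lambda>) * U x) absolutely_integrable_on {0..1}"
    by (intro absolutely_integrable_continuous_real continuous_intros continuous_U)
  moreover have "(\<lambda>x. U x * q x) absolutely_integrable_on {0..1}"
    by (intro absolutely_integrable_continuous_mult continuous_U q)
  ultimately have "(\<lambda>x. (lam0 - \<Lambda>) * U x + U x * q x) absolutely_integrable_on {0..1}"
    by (rule set_integral_add(1))
  then show ?thesis unfolding Fl_def[abs_def] by (simp only: mult.commute[of "q _"])
qed

section \<open>The integral equation for the limit\<close>

lemma summable_lam_Suc: "summable (\<lambda>j. \<bar>lam (Suc j)\<bar>)" "(\<Sum>j. lam (Suc j)) = \<Lambda> - lam0"
proof -
  show "summable (\<lambda>j. \<bar>lam (Suc j)\<bar>)"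
    using summable_abs_lam by (rule summable_Suc_iff[of "\<lambda>j. \<bar>lam j\<bar>", THEN iffD2])
  show "(\<Sum>j. lam (Suc j)) = \<Lambda> - lam0"
    using suminf_split_head[OF summable_lam] by simp
qed

lemma convolution_reindex: "(\<Sum>p=0..k. X (Suc k - p) * Y p) = (\<Sum>i\<le>k. X (Suc i) * Y (k - i))"
  for X Y :: "nat \<Rightarrow> real"
  by (rule sum.reindex_bij_witness[of _ "\<lambda>i. k - i" "\<lambda>p. k - p"]) (auto simp: Suc_diff_le)

lemma F_sums:
  assumes x: "x \<in> {0..1}"
  shows "(\<lambda>j. F (Suc j) x) sums Fl x"
proof -
  have "(\<lambda>k. \<Sum>i\<le>k. lam (Suc i) * u (k - i) x) sums ((\<Sum>j. lam (Suc j)) * (\<Sum>j. u j x))"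
    using summable_lam_Suc(1) summable_abs_u[OF x] by (intro Cauchy_product_sums) auto
  then have "(\<lambda>k. - (\<Sum>i\<le>k. lam (Suc i) * u (k - i) x) + q x * u k x) sums (- ((\<Lambda> - lam0) * U x) + q x * U x)"
    unfolding summable_lam_Suc(2) U_def[symmetric] by (intro sums_add sums_minus sums_mult u_sums[OF x])
  moreover have "- ((\<Lambda> - lam0) * U x) + q x * U x = Fl x" by (simp add: Fl_def algebra_simps)
  ultimately show ?thesis
    unfolding fd_F.simps(2) convolution_reindex[where Y = "\<lambda>p. u p x"] by simp
qed

text \<open>The majorant for dominated convergence: integrable in x and independent of m, because
  the Cauchy product of two summable nonnegative sequences is summable.\<close>

lemma F_partial_sum_bound:
  assumes x: "x \<in> {0..1}"
  shows "\<bar>\<Sum>j\<le>m. F (Suc j) x\<bar> \<le> (\<Sum>j. \<bar>lam (Suc j)\<bar>) * suminf a + suminf a * \<bar>q x\<bar>"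
proof -
  let ?c = "\<lambda>k. \<Sum>i\<le>k. \<bar>lam (Suc i)\<bar> * a (k - i)"
  have conv: "?c sums ((\<Sum>j. \<bar>lam (Suc j)\<bar>) * suminf a)"
    using summable_lam_Suc(1) summable_a a_nonneg by (intro Cauchy_product_sums) auto
  have "\<bar>\<Sum>j\<le>m. F (Suc j) x\<bar> \<le> (\<Sum>j\<le>m. ?c j + a j * \<bar>q x\<bar>)"
    using abs_F_le[OF x] unfolding convolution_reindex[where X = "\<lambda>j. \<bar>lam j\<bar>"]
    by (intro order_trans[OF sum_abs sum_mono]) auto
  also have "\<dots> = (\<Sum>j\<le>m. ?c j) + (\<Sum>j\<le>m. a j) * \<bar>q x\<bar>" by (simp add: sum.distrib sum_distrib_right)
  also have "\<dots> \<le> (\<Sum>j. \<bar>lam (Suc j)\<bar>) * suminf a + suminf a * \<bar>q x\<bar>"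
  proof (intro add_mono mult_right_mono)
    show "(\<Sum>j\<le>m. ?c j) \<le> (\<Sum>j. \<bar>lam (Suc j)\<bar>) * suminf a"
      unfolding sums_unique[OF conv] by (rule sum_le_suminf[OF sums_summable[OF conv]])
        (auto intro!: sum_nonneg mult_nonneg_nonneg a_nonneg)
    show "(\<Sum>j\<le>m. a j) \<le> suminf a"
      by (rule sum_le_suminf[OF summable_a]) (auto intro: a_nonneg)
  qed auto
  finally show ?thesis .
qed

text \<open>The factor q may be unbounded, so the right-hand sides need not converge uniformly;
  dominated convergence with the kernel bound 1 / s replaces uniform convergence.\<close>

lemma z_F_sums:
  assumes x: "x \<in> {0..1}"
  shows "(\<lambda>j. z (F (Suc j)) x) sums z Fl x"
proof -
  let ?k = "\<lambda>\<xi>. sin (s * (x - \<xi>)) / s"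
  let ?H = "\<lambda>\<xi>. (\<Sum>j. \<bar>lam (Suc j)\<bar>) * suminf a + suminf a * \<bar>q \<xi>\<bar>"
  have sub: "{0..x} \<subseteq> {0..1}" using x by auto
  have int: "(\<lambda>\<xi>. ?k \<xi> * F (Suc j) \<xi>) integrable_on {0..x}" for j
    by (intro set_lebesgue_integral_eq_integral(1) absolutely_integrable_continuous_mult continuous_intros
       absolutely_integrable_on_subinterval[OF F_abs_integrable sub]) (use s_pos in auto)
  have "(\<lambda>m. integral {0..x} (\<lambda>\<xi>. ?k \<xi> * (\<Sum>j\<le>m. F (Suc j) \<xi>))) \<longlonglongrightarrow> integral {0..x} (\<lambda>\<xi>. ?k \<xi> * Fl \<xi>)"
  proof (rule dominated_convergence(2)[where h = "\<lambda>\<xi>. 1 / s * ?H \<xi>"])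
    show "(\<lambda>\<xi>. ?k \<xi> * (\<Sum>j\<le>m. F (Suc j) \<xi>)) integrable_on {0..x}" for m
      unfolding sum_distrib_left by (intro integrable_sum int) auto
    show "(\<lambda>\<xi>. 1 / s * ?H \<xi>) integrable_on {0..x}"
      by (intro integrable_on_mult_right integrable_add integrable_subinterval_real[OF abs_q_integrable sub]) auto
    fix m \<xi> assume "\<xi> \<in> {0..x}"
    then have \<xi>: "\<xi> \<in> {0..1}" using sub by blast
    have "\<bar>?k \<xi>\<bar> \<le> 1 / s" using s_pos by (simp add: abs_divide divide_right_mono)
    then show "norm (?k \<xi> * (\<Sum>j\<le>m. F (Suc j) \<xi>)) \<le> 1 / s * ?H \<xi>"
      unfolding real_norm_def abs_mult using s_pos F_partial_sum_bound[OF \<xi>]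
      by (intro mult_mono) auto
  next
    fix \<xi> assume "\<xi> \<in> {0..x}"
    then have "(\<lambda>j. F (Suc j) \<xi>) sums Fl \<xi>" using sub F_sums by blast
    then show "(\<lambda>m. ?k \<xi> * (\<Sum>j\<le>m. F (Suc j) \<xi>)) \<longlonglongrightarrow> ?k \<xi> * Fl \<xi>"
      unfolding sums_def_le by (intro tendsto_mult_left)
  qed
  moreover have "integral {0..x} (\<lambda>\<xi>. ?k \<xi> * (\<Sum>j\<le>m. F (Suc j) \<xi>)) = (\<Sum>j\<le>m. z (F (Suc j)) x)" for m
    unfolding sum_distrib_left z_def by (rule integral_sum[OF finite_atMost int])
  ultimately show ?thesis unfolding sums_def_le by (simp only: z_def)
qed

text \<open>The solution of y'' + s^2 y = Fl with y(0) = 0 and y'(0) = 1, continued past \<alpha>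
  without a jump of the derivative.\<close>

definition zt :: "real \<Rightarrow> real" where "zt x = sin (s * x) / s + z Fl x"

lemma U_eq:
  assumes x: "x \<in> {0..1}"
  shows "U x = zt x + J x * zt \<alpha>"
proof -
  have \<alpha>: "\<alpha> \<in> {0..1}" using \<alpha>0 \<alpha>1 by simp
  have "(\<lambda>j. u (Suc j) x) sums (z Fl x + J x * z Fl \<alpha>)"
    unfolding u_eq_T[OF x] T_def by (intro sums_add sums_mult z_F_sums x \<alpha>)
  then have "(\<lambda>j. u j x) sums (z Fl x + J x * z Fl \<alpha> + u 0 x)" by (rule sums_Suc)
  then have "U x = z Fl x + J x * z Fl \<alpha> + u0 x"
    using u_sums[OF x] by (simp add: sums_unique2 u_0)
  then show ?thesis unfolding u0_eq zt_def by (simp add: distrib_left)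
qed

definition V :: "real \<Rightarrow> real" where "V x = cos (s * x) + integral {0..x} (\<lambda>\<xi>. Fl \<xi> - s\<^sup>2 * z Fl \<xi>)"

lemma zt_has_derivative:
  assumes "x \<in> {0..1}"
  shows "(zt has_real_derivative V x) (at x within {0..1})"
proof -
  have "(z Fl has_real_derivative integral {0..x} (\<lambda>\<xi>. Fl \<xi> - s\<^sup>2 * z Fl \<xi>)) (at x within {0..1})"
    unfolding z_def[abs_def] using duhamel_has_derivative(1)[OF Fl_abs_integrable _ assms, of s] s_pos by simp
  moreover have "((\<lambda>x. sin (s * x) / s) has_real_derivative cos (s * x)) (at x within {0..1})"
    by (rule derivative_eq_intros refl | use s_pos in simp)+
  ultimately show ?thesis unfolding zt_def[abs_def] V_def using DERIV_add by fastforce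
qed

lemma continuous_zt: "continuous_on {0..1} zt"
  using zt_has_derivative by (rule DERIV_continuous_on)

text \<open>What the second derivative of \<open>U\<close> turns out to be almost everywhere, on
  both sides of \<alpha>.\<close>

definition f2 :: "real \<Rightarrow> real" where "f2 x = Fl x - s\<^sup>2 * U x"

lemma f2_abs_integrable: "f2 absolutely_integrable_on {0..1}"
  unfolding f2_def[abs_def]
  by (intro set_integral_diff(1) Fl_abs_integrable absolutely_integrable_continuous_real continuous_intros continuous_U)

lemma f2_eq: "f2 x - q x * U x + \<Lambda> * U x = 0"
  unfolding f2_def Fl_def lam0_eq by (simp add: algebra_simps)

lemma continuous_z_Fl: "continuous_on {0..1} (z Fl)"
  using duhamel_has_derivative(2)[OF Fl_abs_integrable, of s 0] s_pos unfolding z_def[abs_def] by simp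

text \<open>The derivative of the cosine supplies the missing part of \<open>zt\<close> in the
  integrand. The starting point is arbitrary because the right piece starts at \<alpha>.\<close>

lemma V_increment:
  assumes xy: "0 \<le> x" "x \<le> y" "y \<le> 1"
  shows "V y = V x + integral {x..y} (\<lambda>\<xi>. Fl \<xi> - s\<^sup>2 * zt \<xi>)"
proof -
  have i: "(\<lambda>\<xi>. Fl \<xi> - s\<^sup>2 * z Fl \<xi>) integrable_on {0..1}"
    by (intro integrable_diff set_lebesgue_integral_eq_integral(1)[OF Fl_abs_integrable] integrable_continuous_real
      continuous_intros continuous_z_Fl)
  have i': "(\<lambda>\<xi>. Fl \<xi> - s\<^sup>2 * z Fl \<xi>) integrable_on {c..d}" if "0 \<le> c" "d \<le> 1" for c d
    by (rule integrable_subinterval_real[OF i]) (use that in auto)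
  have "integral {0..x} (\<lambda>\<xi>. Fl \<xi> - s\<^sup>2 * z Fl \<xi>) + integral {x..y} (\<lambda>\<xi>. Fl \<xi> - s\<^sup>2 * z Fl \<xi>) =
      integral {0..y} (\<lambda>\<xi>. Fl \<xi> - s\<^sup>2 * z Fl \<xi>)"
    using xy by (intro Henstock_Kurzweil_Integration.integral_combine i') auto
  then have eq: "V y - V x = (cos (s * y) - cos (s * x)) + integral {x..y} (\<lambda>\<xi>. Fl \<xi> - s\<^sup>2 * z Fl \<xi>)"
    unfolding V_def by linarith
  have "((\<lambda>\<xi>. - s * sin (s * \<xi>)) has_integral (cos (s * y) - cos (s * x))) {x..y}"
    using xy(2) by (rule fundamental_theorem_of_calculus)
      (auto simp flip: has_real_derivative_iff_has_vector_derivative intro!: derivative_eq_intros)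
  then have "((\<lambda>\<xi>. - s * sin (s * \<xi>) + (Fl \<xi> - s\<^sup>2 * z Fl \<xi>)) has_integral
     (cos (s * y) - cos (s * x)) + integral {x..y} (\<lambda>\<xi>. Fl \<xi> - s\<^sup>2 * z Fl \<xi>)) {x..y}"
    using xy by (intro has_integral_add integrable_integral i') auto
  moreover have "- s * sin (s * \<xi>) + (Fl \<xi> - s\<^sup>2 * z Fl \<xi>) = Fl \<xi> - s\<^sup>2 * zt \<xi>" for \<xi>
    unfolding zt_def using s_pos by (simp add: field_simps power2_eq_square)
  ultimately have "((\<lambda>\<xi>. Fl \<xi> - s\<^sup>2 * zt \<xi>) has_integral (V y - V x)) {x..y}" by (simp only: eq)
  then show ?thesis by (simp add: integral_unique)
qed

lemma U_is_solution: "is_solution \<alpha> \<beta> q \<Lambda> U"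
  unfolding is_solution_def
proof (intro conjI exI)
  \<comment> \<open>The derivative to the right of \<alpha>: \<open>V\<close> plus the derivative of
    \<open>J x * zt \<alpha>\<close>. At \<alpha> the cosine is 1, which is the jump
    condition.\<close>
  define w where "w x = V x + \<beta> * cos (s * (x - \<alpha>)) * zt \<alpha>" for x
  have Ul: "U x = zt x" if "x \<in> {0..\<alpha>}" for x
    using U_eq[of x] that \<alpha>1 by (simp add: J_def)
  have Jr: "J x = \<beta> / s * sin (s * (x - \<alpha>))" if "x \<in> {\<alpha>..1}" for x
    using that by (simp add: J_def)
  have Vl: "V x = V 0 + integral {0..x} f2" if x: "x \<in> {0..\<alpha>}" for x
  proof -
    have "integral {0..x} (\<lambda>\<xi>. Fl \<xi> - s\<^sup>2 * zt \<xi>) = integral {0..x} f2"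
      by (rule Henstock_Kurzweil_Integration.integral_cong) (use x Ul in \<open>simp add: f2_def\<close>)
    then show ?thesis using V_increment[of 0 x] x \<alpha>1 by simp
  qed
  \<comment> \<open>The jump term adds its own second derivative, which completes \<open>zt\<close>
    to \<open>U\<close> in the integrand and so produces the same \<open>f2\<close> as on the
    left.\<close>
  have wr: "w x = w \<alpha> + integral {\<alpha>..x} f2" if x: "x \<in> {\<alpha>..1}" for x
  proof -
    have "((\<lambda>\<xi>. - (s\<^sup>2 * (J \<xi> * zt \<alpha>))) has_integral (\<beta> * cos (s * (x - \<alpha>)) * zt \<alpha> - \<beta> * cos (s * (\<alpha> - \<alpha>)) * zt \<alpha>)) {\<alpha>..x}"
    proof (rule fundamental_theorem_of_calculus)
      fix y assume y: "y \<in> {\<alpha>..x}"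
      have "((\<lambda>x. \<beta> * cos (s * (x - \<alpha>)) * zt \<alpha>) has_real_derivative - (\<beta> * s * sin (s * (y - \<alpha>)) * zt \<alpha>)) (at y within {\<alpha>..x})"
        by (rule derivative_eq_intros refl | simp)+
      moreover have "\<beta> * s * sin (s * (y - \<alpha>)) * zt \<alpha> = s\<^sup>2 * (J y * zt \<alpha>)"
        using Jr[of y] x y s_pos by (simp add: power2_eq_square)
      ultimately show "((\<lambda>x. \<beta> * cos (s * (x - \<alpha>)) * zt \<alpha>) has_vector_derivative - (s\<^sup>2 * (J y * zt \<alpha>))) (at y within {\<alpha>..x})"
        unfolding has_real_derivative_iff_has_vector_derivative by simp
    qed (use x in simp)
    moreover have "((\<lambda>\<xi>. Fl \<xi> - s\<^sup>2 * zt \<xi>) has_integral (V x - V \<alpha>)) {\<alpha>..x}"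
    proof -
      have "(\<lambda>\<xi>. Fl \<xi> - s\<^sup>2 * zt \<xi>) integrable_on {0..1}"
        by (intro integrable_diff set_lebesgue_integral_eq_integral(1)[OF Fl_abs_integrable] integrable_continuous_real
          continuous_intros continuous_zt)
      then have "(\<lambda>\<xi>. Fl \<xi> - s\<^sup>2 * zt \<xi>) integrable_on {\<alpha>..x}"
        by (rule integrable_subinterval_real) (use x \<alpha>0 in auto)
      then show ?thesis using V_increment[of \<alpha> x] x \<alpha>0 by (simp add: has_integral_integral)
    qed
    ultimately have "((\<lambda>\<xi>. (Fl \<xi> - s\<^sup>2 * zt \<xi>) + - (s\<^sup>2 * (J \<xi> * zt \<alpha>))) has_integral
      (V x - V \<alpha>) + (\<beta> * cos (s * (x - \<alpha>)) * zt \<alpha> - \<beta> * cos (s * (\<alpha> - \<alpha>)) * zt \<alpha>)) {\<alpha>..x}"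
      by (intro has_integral_add)
    moreover have "(V x - V \<alpha>) + (\<beta> * cos (s * (x - \<alpha>)) * zt \<alpha> - \<beta> * cos (s * (\<alpha> - \<alpha>)) * zt \<alpha>) = w x - w \<alpha>"
      by (simp add: w_def)
    ultimately have "((\<lambda>\<xi>. (Fl \<xi> - s\<^sup>2 * zt \<xi>) + - (s\<^sup>2 * (J \<xi> * zt \<alpha>))) has_integral (w x - w \<alpha>)) {\<alpha>..x}"
      by (simp only:)
    then have "(f2 has_integral (w x - w \<alpha>)) {\<alpha>..x}"
      by (rule has_integral_eq[rotated]) (use x \<alpha>0 in \<open>simp add: f2_def U_eq algebra_simps\<close>)
    then show ?thesis by (simp add: integral_unique)
  qed
  have f2l: "f2 absolutely_integrable_on {0..\<alpha>}" and f2r: "f2 absolutely_integrable_on {\<alpha>..1}"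
    using \<alpha>0 \<alpha>1 by (auto intro: absolutely_integrable_on_subinterval[OF f2_abs_integrable])
  show "continuous_on {0..1} U" by (rule continuous_U)
  show "\<forall>x\<in>{0..\<alpha>}. (U has_real_derivative V x) (at x within {0..\<alpha>})"
  proof
    fix x assume x: "x \<in> {0..\<alpha>}"
    then have "(zt has_real_derivative V x) (at x within {0..\<alpha>})"
      using \<alpha>1 by (intro DERIV_subset[OF zt_has_derivative]) auto
    then show "(U has_real_derivative V x) (at x within {0..\<alpha>})"
      by (rule has_field_derivative_transform_within[where d = 1]) (use x Ul in auto)
  qed
  show "\<forall>x\<in>{\<alpha>..1}. (U has_real_derivative w x) (at x within {\<alpha>..1})"
  proof
    fix x assume x: "x \<in> {\<alpha>..1}"
    then have "(zt has_real_derivative V x) (at x within {\<alpha>..1})"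
      using \<alpha>0 by (intro DERIV_subset[OF zt_has_derivative]) auto
    moreover have "((\<lambda>x. \<beta> / s * sin (s * (x - \<alpha>)) * zt \<alpha>) has_real_derivative \<beta> * cos (s * (x - \<alpha>)) * zt \<alpha>) (at x within {\<alpha>..1})"
      by (rule derivative_eq_intros refl | use s_pos in simp)+
    ultimately have "((\<lambda>x. zt x + \<beta> / s * sin (s * (x - \<alpha>)) * zt \<alpha>) has_real_derivative w x) (at x within {\<alpha>..1})"
      unfolding w_def by (rule DERIV_add)
    then show "(U has_real_derivative w x) (at x within {\<alpha>..1})"
      by (rule has_field_derivative_transform_within[where d = 1]) (use x \<alpha>0 U_eq Jr in auto)
  qed
  show "abs_continuous_on 0 \<alpha> V" by (rule abs_continuous_on_indefinite_integral[OF f2l Vl])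
  show "abs_continuous_on \<alpha> 1 w" by (rule abs_continuous_on_indefinite_integral[OF f2r wr])
  show "AE x in lebesgue. x \<in> {0<..<\<alpha>} \<longrightarrow>
     (\<exists>u''. (V has_real_derivative u'') (at x) \<and> u'' - q x * U x + \<Lambda> * U x = 0)"
    using AE_has_derivative_if_integral[OF f2l Vl] by (rule AE_mp) (auto intro!: AE_I2 exI f2_eq)
  show "AE x in lebesgue. x \<in> {\<alpha><..<1} \<longrightarrow>
     (\<exists>u''. (w has_real_derivative u'') (at x) \<and> u'' - q x * U x + \<Lambda> * U x = 0)"
    using AE_has_derivative_if_integral[OF f2r wr] by (rule AE_mp) (auto intro!: AE_I2 exI f2_eq)
  show "U 0 = 0" using Ul[of 0] \<alpha>0 by (simp add: zt_def z_def)
  show "U 1 = 0"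
  proof -
    \<comment> \<open>The two-branch form pays off here: at x = 1 both sin (s * (1 - x)) and the
      integral over x..1 vanish.\<close>
    have "u j 1 = 0" for j using \<alpha>1 by (cases j) (simp_all add: fd_u0_def fd_u.simps(2))
    then show ?thesis by (simp add: U_def)
  qed
  show "V 0 = 1" by (simp add: V_def)
  show "w \<alpha> - V \<alpha> = \<beta> * U \<alpha>" using Ul[of \<alpha>] \<alpha>0 by (simp add: w_def)
qed

section \<open>The error estimates\<close>

lemma u_error_bound:
  "norm_inf (\<lambda>x. U x - (\<Sum>j\<le>m. u j x))
    \<le> fd_C \<alpha> \<beta> q n m * Min {1 / M, 1 / s, 1 / (s * sqrt ct)} * r ^ (m + 1)"
proof -
  \<comment> \<open>The tail bound contains 1 / b. The three entries of \<open>fd_b\<close> give the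
    three comparisons of 1 / b with M times an entry of the minimum.\<close>
  have "s \<le> M * b" "s * sqrt ct \<le> M * b" using b_ge M_pos by (simp_all add: pos_divide_le_eq mult.commute)
  then have "1 / b \<le> M * (1 / M)" "1 / b \<le> M * (1 / s)" "1 / b \<le> M * (1 / (s * sqrt ct))"
    using b_ge(1) b_pos M_pos s_pos sqrt_ct_pos by (simp_all add: field_simps)
  then have "1 / b \<le> M * y" if "y \<in> {1 / M, 1 / s, 1 / (s * sqrt ct)}" for y
    using that by (elim insertE emptyE) (simp_all only:)
  then have "1 / b \<le> M * Min {1 / M, 1 / s, 1 / (s * sqrt ct)}"
    using Min_in[of "{1 / M, 1 / s, 1 / (s * sqrt ct)}"] by blast
  then have "fd_alpha (Suc m) * r ^ (m + 1) / (1 - r) * (1 / b) \<le>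
    fd_alpha (Suc m) * r ^ (m + 1) / (1 - r) * (M * Min {1 / M, 1 / s, 1 / (s * sqrt ct)})"
    using fd_alpha_nonneg fd_coefficient_bounds(2) r1 by (intro mult_left_mono) auto
  also have "\<dots> = fd_C \<alpha> \<beta> q n m * Min {1 / M, 1 / s, 1 / (s * sqrt ct)} * r ^ (m + 1)"
    unfolding fd_C_def by simp
  finally have "r / b * (fd_alpha (Suc m) * r ^ m) / (1 - r) \<le> \<dots>"
    by (simp add: mult_ac)
  then show ?thesis using u_tail by (intro norm_inf_le) (meson order_trans)
qed

lemma lam_error_bound:
  "\<bar>\<Lambda> - (\<Sum>j\<le>m. lam j)\<bar>
    \<le> fd_C \<alpha> \<beta> q n m / ((M + Max {1, ct, sqrt ct * M / s}) * fd_R \<alpha> \<beta> q n) * r ^ m"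
proof -
  define X where "X = Max {1, ct, sqrt ct * M / s}"
  have "X \<ge> 1" unfolding X_def by (rule Max_ge) auto
  then have MX: "M + X > 0" using M_pos by linarith
  have "X \<le> v0 * M" using v0_ge M_pos unfolding X_def[symmetric] by (simp add: divide_le_eq)
  then have "M + X \<le> (1 + v0) * M" by (simp add: algebra_simps)
  \<comment> \<open>The factor 1 / (1 + \<open>v0\<close>) comes from rewriting Q / \<rho> through
    \<open>fd_R\<close>; this inequality trades it for the explicit denominator.\<close>
  then have key: "1 / (1 + v0) \<le> M / (M + X)"
    using MX v0_pos by (simp add: field_simps)
  \<comment> \<open>For Q = 0 both sides are 0 by the convention on division by zero.\<close>
  have QR: "Q / \<rho> = 1 / (1 + v0) * (1 / fd_R \<alpha> \<beta> q n)"
    unfolding fd_R_def \<rho>_def[symmetric] using v0_pos by simp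
  have R: "1 / fd_R \<alpha> \<beta> q n \<ge> 0"
    unfolding fd_R_def \<rho>_def[symmetric] using v0_pos fd_coefficient_bounds(1) norm_L1_nonneg by simp
  have "\<bar>\<Lambda> - (\<Sum>j\<le>m. lam j)\<bar> \<le> 1 / (1 + v0) * (1 / fd_R \<alpha> \<beta> q n) * (fd_alpha (Suc m) * r ^ m) / (1 - r)"
    using lam_tail unfolding QR .
  also have "\<dots> \<le> M / (M + X) * (1 / fd_R \<alpha> \<beta> q n) * (fd_alpha (Suc m) * r ^ m) / (1 - r)"
    using key R fd_alpha_nonneg fd_coefficient_bounds(2) r1
    by (intro divide_right_mono mult_right_mono) auto
  also have "\<dots> = fd_C \<alpha> \<beta> q n m / ((M + X) * fd_R \<alpha> \<beta> q n) * r ^ m"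
    unfolding fd_C_def by (simp add: mult_ac)
  finally show ?thesis unfolding X_def .
qed

end

theorem theorem4p1:
  fixes \<alpha> \<beta> :: real and q :: "real \<Rightarrow> real" and n :: nat
  assumes "0 < \<alpha>" and "\<alpha> < 1" and "\<beta> \<ge> 0"
    and "q absolutely_integrable_on {0..1}"
    and "n > 0"
    and "fd_r \<alpha> \<beta> q n < 1"
  shows "summable (fd_lam \<alpha> \<beta> q n) \<and>
    (\<exists>u. uniform_limit {0..1} (\<lambda>m x. \<Sum>j\<le>m. fd_u \<alpha> \<beta> q n j x) u sequentially \<and>
      is_solution \<alpha> \<beta> q (\<Sum>j. fd_lam \<alpha> \<beta> q n j) u \<and>
      (\<forall>m.
        norm_inf (\<lambda>x. u x - (\<Sum>j\<le>m. fd_u \<alpha> \<beta> q n j x))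
          \<le> fd_C \<alpha> \<beta> q n m
             * Min {1 / fd_M \<alpha> \<beta> n, 1 / fd_s \<alpha> \<beta> n, 1 / (fd_s \<alpha> \<beta> n * sqrt (fd_ctilde \<alpha> \<beta> n))}
             * fd_r \<alpha> \<beta> q n ^ (m + 1) \<and>
        \<bar>(\<Sum>j. fd_lam \<alpha> \<beta> q n j) - (\<Sum>j\<le>m. fd_lam \<alpha> \<beta> q n j)\<bar>
          \<le> fd_C \<alpha> \<beta> q n m
             / ((fd_M \<alpha> \<beta> n
                 + Max {1, fd_ctilde \<alpha> \<beta> n,
                        sqrt (fd_ctilde \<alpha> \<beta> n) * fd_M \<alpha> \<beta> n / fd_s \<alpha> \<beta> n})
                * fd_R \<alpha> \<beta> q n)
             * fd_r \<alpha> \<beta> q n ^ m))"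
proof -
  interpret fd_convergent \<alpha> \<beta> q n using assms by unfold_locales
  show ?thesis
    by (intro conjI exI[of _ U] allI summable_lam uniform_limit_u U_is_solution u_error_bound lam_error_bound)
qed

end
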